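(* Let $d\ge 1$ be an integer, let $0<\alpha<\beta<1/2$, $\sigma>0$, $\zeta\in\mathbb{R}$, and let $G_n=G_n(\alpha,\beta,\sigma,\zeta)$ be the modified Newman-Watts random graph on the $d$-dimensional lattice torus $T_n^d$. Let ${\rm diam}(G_n)$ denote its graph diameter. A. Suppose that $\Gamma:=(2\beta)^d-(2\alpha)^d>1/2$. Then: (i) if $0<\zeta<1$ and $\sigma>0$, or if $\zeta=0$ and $\sigma$ is large enough (i.e. $\sigma\ge\sigma_0$ for some $\sigma_0=\sigma_0(d,\alpha,\beta)$), there exists a constant $C_1>0$ (not depending on $n$) such that $$\lim_{n\to\infty}\mathbb{P}\big({\rm diam}(G_n)\le C_1\ln^3 n\big)=1;$$ (ii) if $\zeta>1$ and $\sigma>0$, or if $\zeta=1$ and $\sigma$ is large enough (i.e. $\sigma\ge\sigma_1$ for some $\sigma_1=\sigma_1(d,\alpha,\beta)$), there exists a constant $C_2>0$ (not depending on $n$) such that $$\lim_{n\to\infty}\mathbb{P}\big({\rm diam}(G_n)\le C_2\ln^2 n\big)=1.$$ B. Suppose $\sigma>0$, $\zeta<1$ and $0<\alpha<\beta<1/2$ (no condition on $\Gamma$). Then for every $0<\nu<(1-\zeta)/d$, $$\lim_{n\to\infty}\mathbb{P}\big({\rm diam}(G_n)\ge \ln^{\nu} n\big)=1;$$ furthermore, if $\sigma>0$ is small enough (i.e. $\sigma\le\sigma_2$ for some $\sigma_2>0$ depending only on $d,\alpha,\beta,\zeta$), then $$\lim_{n\to\infty}\mathbb{P}\big({\rm diam}(G_n)\ge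 \ln^{(1-\zeta)/d} n\big)=1.$$
   Context: Here $\ln$ is the natural logarithm and $\ln^{s} n:=(\ln n)^{s}$. $T_n^d$ is the $d$-dimensional lattice torus obtained from $\mathbb{Z}^d\cap[0,n]^d$ by identifying opposite faces; it has $n^d$ vertices and nearest-neighbour edges. $d^T_\infty$ is the $l_\infty$ metric on the torus: $d^T_\infty(x,y)=\max_{1\le s\le d}\min(|x_s-y_s|,n-|x_s-y_s|)$. The modified Newman-Watts graph $G_n=G_n(\alpha,\beta,\sigma,\zeta)=(V_n,E_n)$ is the random graph with vertex set $V_n=T_n^d$ containing all (nearest-neighbour) edges of $T_n^d$ and, in addition, for each unordered pair $\{u,v\}\subset V_n$ with $\alpha n\le d^T_\infty(u,v)\le\beta n$, independently over pairs, a "long edge" joining $u$ and $v$ with probability $p_n=\sigma n^{-d}\ln^{\zeta}n$ ($n$ is taken large enough that $p_n\le 1$). The diameter is the maximum, over pairs of vertices, of the number of edges in a shortest path between them. *)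

theory Defs
  imports "HOL-Probability.Probability" "HOL-Probability.Product_PMF"
begin

text \<open>
  Finite simple graphs are given by a vertex set and a set of unordered pairs \<open>{u, v}\<close>.
\<close>

definition is_path :: "'v set \<Rightarrow> 'v set set \<Rightarrow> 'v \<Rightarrow> 'v list \<Rightarrow> 'v \<Rightarrow> bool" where
  "is_path V E u p v \<longleftrightarrow>
     p \<noteq> [] \<and> hd p = u \<and> last p = v \<and> distinct p \<and> set p \<subseteq> V \<and>
     successively (\<lambda>x y. {x, y} \<in> E) p"

text \<open>
  The least number of edges of a path; a path listed as \<open>p\<close> has \<open>length p - 1\<close> edges.
  The value is meaningful only if \<open>u\<close> and \<open>v\<close> are connected, which is always the case
  below, since the random graph contains the torus.
\<close>

definition graph_dist :: "'v set \<Rightarrow> 'v set set \<Rightarrow> 'v \<Rightarrow> 'v \<Rightarrow> nat" where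
  "graph_dist V E u v = (LEAST k. \<exists>p. is_path V E u p v \<and> length p - 1 = k)"

definition graph_diam :: "'v set \<Rightarrow> 'v set set \<Rightarrow> nat" where
  "graph_diam V E = Max {graph_dist V E u v | u v. u \<in> V \<and> v \<in> V}"

text \<open>
  After identification of opposite faces, every vertex of the torus has a unique
  representative with coordinates in \<open>{0, \<dots>, n - 1}\<close>; coordinates are indexed by \<open>s < d\<close>.
\<close>

definition torus_verts :: "nat \<Rightarrow> nat \<Rightarrow> (nat \<Rightarrow> nat) set" where
  "torus_verts d n = (\<Pi>\<^sub>E s\<in>{..<d}. {..<n})"

definition torus_edges :: "nat \<Rightarrow> nat \<Rightarrow> (nat \<Rightarrow> nat) set set" where
  "torus_edges d n =
     {{x, x(s := (x s + 1) mod n)} | x s. x \<in> torus_verts d n \<and> s < d}"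

definition torus_dist :: "nat \<Rightarrow> nat \<Rightarrow> (nat \<Rightarrow> nat) \<Rightarrow> (nat \<Rightarrow> nat) \<Rightarrow> int" where
  "torus_dist d n x y =
     Max ((\<lambda>s. min \<bar>int (x s) - int (y s)\<bar> (int n - \<bar>int (x s) - int (y s)\<bar>)) ` {..<d})"

definition long_pairs :: "nat \<Rightarrow> real \<Rightarrow> real \<Rightarrow> nat \<Rightarrow> (nat \<Rightarrow> nat) set set" where
  "long_pairs d \<alpha> \<beta> n =
     {{u, v} | u v. u \<in> torus_verts d n \<and> v \<in> torus_verts d n \<and> u \<noteq> v \<and>
        \<alpha> * real n \<le> real_of_int (torus_dist d n u v) \<and>
        real_of_int (torus_dist d n u v) \<le> \<beta> * real n}"

definition long_edge_prob :: "nat \<Rightarrow> real \<Rightarrow> real \<Rightarrow> nat \<Rightarrow> real" where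
  "long_edge_prob d \<sigma> \<zeta> n = \<sigma> * real n powr (- real d) * (ln (real n)) powr \<zeta>"

text \<open>
  The law of the random edge set \<open>E\<^sub>n\<close>. For the finitely many \<open>n\<close> with
  \<open>long_edge_prob d \<sigma> \<zeta> n > 1\<close>, \<open>bernoulli_pmf\<close> replaces the parameter by \<open>1\<close>.
\<close>

definition newman_watts ::
  "nat \<Rightarrow> real \<Rightarrow> real \<Rightarrow> real \<Rightarrow> real \<Rightarrow> nat \<Rightarrow> (nat \<Rightarrow> nat) set set pmf" where
  "newman_watts d \<alpha> \<beta> \<sigma> \<zeta> n =
     map_pmf (\<lambda>present. torus_edges d n \<union> {e \<in> long_pairs d \<alpha> \<beta> n. present e})
       (Pi_pmf (long_pairs d \<alpha> \<beta> n) False (\<lambda>_. bernoulli_pmf (long_edge_prob d \<sigma> \<zeta> n)))"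

end

theory Submission
  imports Defs "HOL-Real_Asymp.Real_Asymp"
begin

text \<open>
  Upper bounds. Cut the torus into cells of side \<open>L \<approx> (ln n) powr \<kappa>\<close>, where \<open>\<kappa> = 1/d\<close> if
  \<open>\<zeta> < 1\<close> and \<open>\<kappa> = 0\<close> otherwise, so that a cell sends out a large multiple of \<open>ln n\<close> long edges on
  average. Since \<open>\<Gamma> > 1/2\<close>, every vertex has a positive fraction of all vertices as potential long
  neighbours outside any given set that is not much larger than half of the torus. A union bound
  over pairs \<open>S \<subseteq> W\<close> of sets of cells then shows that, with high probability, every set of at most
  half of the cells expands by a constant factor. Balls in the graph of cells therefore exceed half
  of it after \<open>O(ln n)\<close> steps, any two of them meet, and the diameter is \<open>O(L ln n)\<close>, which is
  \<open>O((ln n) powr (1 + 1/d))\<close> in part (i) and \<open>O(ln n)\<close> in part (ii).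

  Lower bounds. Place about \<open>sqrt n\<close> disjoint balls of radius about \<open>(ln n) powr \<nu>\<close> on a segment of
  length at most \<open>\<alpha> n\<close>. No long pair joins two of them, so the events that a ball meets no long edge
  are independent, and each has probability at least \<open>n powr (-1/4)\<close>. Hence with high probability
  some ball is isolated, and leaving it from its centre takes \<open>(ln n) powr \<nu>\<close> steps.
\<close>

section \<open>Distance and diameter of a graph\<close>

definition within_steps :: "('a \<times> 'a) set \<Rightarrow> nat \<Rightarrow> ('a \<times> 'a) set" where
  "within_steps R k = (R\<^sup>=) ^^ k"

lemma within_steps_0 [simp]: "within_steps R 0 = Id"
  by (simp add: within_steps_def)

lemma within_steps_Suc: "within_steps R (Suc k) = within_steps R k O R\<^sup>="
  by (simp add: within_steps_def)

lemma within_steps_refl: "(x, x) \<in> within_steps R k"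
  by (induction k) (auto simp: within_steps_Suc)

lemma within_steps_step: "r \<in> R \<Longrightarrow> r \<in> within_steps R 1"
  by (auto simp: within_steps_def)

lemma within_steps_trans:
  "(x, y) \<in> within_steps R j \<Longrightarrow> (y, z) \<in> within_steps R k \<Longrightarrow> (x, z) \<in> within_steps R (j + k)"
  unfolding within_steps_def by (rule relpow_trans)

lemma within_steps_mono:
  assumes "(x, y) \<in> within_steps R j" "j \<le> k"
  shows "(x, y) \<in> within_steps R k"
  using within_steps_trans[OF assms(1) within_steps_refl, of "k - j"] assms(2) by simp

lemma within_steps_sym:
  assumes "sym R" "(x, y) \<in> within_steps R k"
  shows "(y, x) \<in> within_steps R k"
  using assms(2)
proof (induction k arbitrary: y)
  case (Suc k)
  then obtain z where "(x, z) \<in> within_steps R k" "(z, y) \<in> R\<^sup>="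
    by (auto simp: within_steps_Suc)
  moreover from this have "(y, z) \<in> within_steps R 1"
    using assms(1) by (auto simp: within_steps_def dest: symD)
  ultimately show ?case
    using Suc.IH within_steps_trans[of y z R 1 x k] by simp
qed simp

definition edge_rel :: "'v set \<Rightarrow> 'v set set \<Rightarrow> ('v \<times> 'v) set" where
  "edge_rel V E = {(x, y). x \<in> V \<and> y \<in> V \<and> {x, y} \<in> E}"

lemma sym_edge_rel: "sym (edge_rel V E)"
  by (auto simp: edge_rel_def sym_def insert_commute)

lemma edge_rel_mono: "E \<subseteq> E' \<Longrightarrow> edge_rel V E \<subseteq> edge_rel V E'"
  by (auto simp: edge_rel_def)

lemma edge_rel_subset: "edge_rel V E \<subseteq> V \<times> V"
  by (auto simp: edge_rel_def)

lemma is_path_snoc: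
  assumes "is_path V E u p w" "(w, v) \<in> edge_rel V E" "v \<notin> set p"
  shows "is_path V E u (p @ [v]) v"
  using assms by (auto simp: is_path_def edge_rel_def successively_append_iff)

lemma is_path_prefix:
  assumes "is_path V E u p w" "v \<in> set p"
  obtains q where "is_path V E u q v" "length q \<le> length p"
proof -
  obtain xs ys where "p = xs @ v # ys"
    using assms(2) by (meson split_list)
  then have split: "p = (xs @ [v]) @ ys" by simp
  have "is_path V E u (xs @ [v]) v"
    using assms(1) unfolding is_path_def split successively_append_iff[of _ "xs @ [v]"]
    by (auto simp: hd_append)
  then show ?thesis using that split by auto
qed

lemma within_steps_imp_path:
  assumes "u \<in> V" "(u, v) \<in> within_steps (edge_rel V E) k"
  obtains p where "is_path V E u p v" "length p \<le> Suc k"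
proof -
  have "\<exists>p. is_path V E u p v \<and> length p \<le> Suc k"
    using assms(2)
  proof (induction k arbitrary: v)
    case 0
    then have "is_path V E u [u] v" using assms(1) by (simp add: is_path_def)
    then show ?case by fastforce
  next
    case (Suc k)
    then obtain w where w: "(u, w) \<in> within_steps (edge_rel V E) k" "(w, v) \<in> (edge_rel V E)\<^sup>="
      by (auto simp: within_steps_Suc)
    obtain p where p: "is_path V E u p w" "length p \<le> Suc k"
      using Suc.IH[OF w(1)] by auto
    show ?case
    proof (cases "v \<in> set p")
      case True
      then obtain q where "is_path V E u q v" "length q \<le> length p"
        using is_path_prefix[OF p(1)] by blast
      then show ?thesis using p(2) by (intro exI[of _ q]) auto
    next
      case False
      then have "w \<noteq> v" using p(1) by (auto simp: is_path_def)
      then have "is_path V E u (p @ [v]) v" using is_path_snoc[OF p(1)] w(2) False by auto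
      then show ?thesis using p(2) by (intro exI[of _ "p @ [v]"]) auto
    qed
  qed
  then show ?thesis using that by blast
qed

lemma graph_dist_le:
  assumes "u \<in> V" "(u, v) \<in> within_steps (edge_rel V E) k"
  shows "graph_dist V E u v \<le> k"
proof -
  obtain p where p: "is_path V E u p v" "length p \<le> Suc k"
    using within_steps_imp_path[OF assms] .
  have "graph_dist V E u v \<le> length p - 1"
    unfolding graph_dist_def using p(1) by (intro Least_le) auto
  with p(2) show ?thesis by simp
qed

lemma graph_dist_path:
  assumes "u \<in> V" "(u, v) \<in> within_steps (edge_rel V E) k"
  obtains p where "is_path V E u p v" "length p - 1 = graph_dist V E u v"
proof -
  have "\<exists>j p. is_path V E u p v \<and> length p - 1 = j"
    using within_steps_imp_path[OF assms] by metis
  then have "\<exists>p. is_path V E u p v \<and> length p - 1 = graph_dist V E u v"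
    unfolding graph_dist_def by (rule LeastI_ex)
  then show ?thesis using that by blast
qed

lemma less_graph_dist_of_potential:
  fixes f :: "'v \<Rightarrow> int"
  assumes "u \<in> V" "(u, v) \<in> within_steps (edge_rel V E) k"
    and "f u \<le> 0" "int t < f v"
    and step: "\<And>x y. (x, y) \<in> edge_rel V E \<Longrightarrow> f x \<le> int t \<Longrightarrow> f y \<le> f x + 1"
  shows "t < graph_dist V E u v"
proof (rule ccontr)
  assume "\<not> t < graph_dist V E u v"
  moreover obtain p where p: "is_path V E u p v" "length p - 1 = graph_dist V E u v"
    using graph_dist_path[OF assms(1,2)] .
  ultimately have len: "length p - 1 \<le> t" by simp
  have "f (p ! i) \<le> int i" if "i < length p" for i
    using that
  proof (induction i)
    case 0
    then show ?case using p(1) assms(3) by (auto simp: is_path_def hd_conv_nth)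
  next
    case (Suc i)
    have "(p ! i, p ! Suc i) \<in> edge_rel V E"
      using p(1) Suc.prems nth_mem[of i p] nth_mem[of "Suc i" p]
      by (auto simp: is_path_def edge_rel_def successively_conv_nth)
    moreover have "f (p ! i) \<le> int i" using Suc by simp
    ultimately show ?case using step len Suc.prems by fastforce
  qed
  moreover have "p ! (length p - 1) = v" "length p - 1 < length p"
    using p(1) by (auto simp: is_path_def last_conv_nth)
  ultimately have "f v \<le> int (length p - 1)" by metis
  then show False using len assms(4) by linarith
qed

lemma graph_diam_alt: "graph_diam V E = Max ((\<lambda>(u, v). graph_dist V E u v) ` (V \<times> V))"
  unfolding graph_diam_def by (rule arg_cong[of _ _ Max]) auto

lemma graph_diam_le:
  assumes "finite V" "V \<noteq> {}"
    and "\<And>u v. u \<in> V \<Longrightarrow> v \<in> V \<Longrightarrow> (u, v) \<in> within_steps (edge_rel V E) k"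
  shows "graph_diam V E \<le> k"
  unfolding graph_diam_alt
  using assms by (subst Max_le_iff) (auto intro!: graph_dist_le)

lemma graph_dist_le_diam:
  assumes "finite V" "u \<in> V" "v \<in> V"
  shows "graph_dist V E u v \<le> graph_diam V E"
  unfolding graph_diam_alt using assms by (intro Max_ge) auto

section \<open>Expansion and coarse graining\<close>

definition quotient_rel :: "('v \<Rightarrow> 'j) \<Rightarrow> ('v \<times> 'v) set \<Rightarrow> ('j \<times> 'j) set" where
  "quotient_rel \<pi> R = map_prod \<pi> \<pi> ` R"

lemma quotient_relI: "(x, y) \<in> R \<Longrightarrow> (\<pi> x, \<pi> y) \<in> quotient_rel \<pi> R"
  unfolding quotient_rel_def by (rule map_prod_imageI)

lemma quotient_relE:
  assumes "(i, j) \<in> quotient_rel \<pi> R"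
  obtains x y where "(x, y) \<in> R" "i = \<pi> x" "j = \<pi> y"
  using assms unfolding quotient_rel_def by auto

lemma quotient_rel_mono: "R \<subseteq> R' \<Longrightarrow> quotient_rel \<pi> R \<subseteq> quotient_rel \<pi> R'"
  unfolding quotient_rel_def by (rule image_mono)

lemma quotient_edge_rel_subset: "quotient_rel \<pi> (edge_rel V E) \<subseteq> \<pi> ` V \<times> \<pi> ` V"
  unfolding quotient_rel_def
  using image_mono[OF edge_rel_subset, of "map_prod \<pi> \<pi>"] by (simp add: map_prod_surj_on)

definition expanding :: "'j set \<Rightarrow> real \<Rightarrow> ('j \<times> 'j) set \<Rightarrow> bool" where
  "expanding J \<eta> A \<longleftrightarrow> (\<forall>S \<subseteq> J. S \<noteq> {} \<and> 2 * card S \<le> card J \<longrightarrow>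
     (1 + \<eta>) * real (card S) \<le> real (card (S \<union> A `` S)))"

lemma expanding_mono:
  assumes "expanding J \<eta> A" "A \<subseteq> A'" "A' \<subseteq> J \<times> J" "finite J"
  shows "expanding J \<eta> A'"
  unfolding expanding_def
proof (intro allI impI)
  fix S assume S: "S \<subseteq> J" "S \<noteq> {} \<and> 2 * card S \<le> card J"
  have "S \<union> A' `` S \<subseteq> J" using S(1) assms(3) by blast
  then have "finite (S \<union> A' `` S)" using assms(4) by (rule finite_subset)
  then have "card (S \<union> A `` S) \<le> card (S \<union> A' `` S)" using assms(2) by (intro card_mono) auto
  moreover have "(1 + \<eta>) * real (card S) \<le> real (card (S \<union> A `` S))"
    using assms(1) S by (simp add: expanding_def)
  ultimately show "(1 + \<eta>) * real (card S) \<le> real (card (S \<union> A' `` S))" by linarith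
qed

lemma within_steps_Image_subset:
  assumes "A \<subseteq> J \<times> J" "X \<subseteq> J"
  shows "within_steps A k `` X \<subseteq> J"
proof (induction k)
  case (Suc k)
  then show ?case using assms(1) by (auto simp: within_steps_Suc)
qed (use assms(2) in auto)

lemma expanding_ball_card:
  assumes "finite J" "A \<subseteq> J \<times> J" "\<eta> > 0" "expanding J \<eta> A" "i \<in> J"
  shows "card J < 2 * card (within_steps A r `` {i}) \<or>
    (1 + \<eta>) ^ r \<le> real (card (within_steps A r `` {i}))"
proof (induction r)
  case (Suc r)
  let ?ball = "\<lambda>r. within_steps A r `` {i}"
  have ball_Suc: "?ball (Suc r) = ?ball r \<union> A `` ?ball r"
    by (auto simp: within_steps_Suc)
  have ball_subset: "?ball k \<subseteq> J" for k
    using assms(2,5) by (intro within_steps_Image_subset) auto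
  show ?case
  proof (cases "card J < 2 * card (?ball r)")
    case True
    moreover have "card (?ball r) \<le> card (?ball (Suc r))"
      using finite_subset[OF ball_subset[of "Suc r"] assms(1)] by (intro card_mono) (auto simp: ball_Suc)
    ultimately show ?thesis by linarith
  next
    case False
    have "i \<in> ?ball r" using within_steps_refl by (intro ImageI) auto
    then have "(1 + \<eta>) * real (card (?ball r)) \<le> real (card (?ball (Suc r)))"
      using assms(4) ball_subset[of r] False unfolding ball_Suc expanding_def
      by (metis empty_iff linorder_not_less)
    moreover have "(1 + \<eta>) * (1 + \<eta>) ^ r \<le> (1 + \<eta>) * real (card (?ball r))"
      using Suc.IH False assms(3) by (intro mult_left_mono) auto
    ultimately show ?thesis by simp
  qed
qed simp

lemma expanding_balls_meet:
  assumes "finite J" "A \<subseteq> J \<times> J" "\<eta> > 0" "expanding J \<eta> A"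
    and radius: "real (card J) \<le> (1 + \<eta>) ^ r" and ij: "i \<in> J" "j \<in> J"
  obtains k where "(i, k) \<in> within_steps A r" "(j, k) \<in> within_steps A r"
proof -
  let ?ball = "\<lambda>i. within_steps A r `` {i}"
  have ball_subset: "?ball i \<subseteq> J" if "i \<in> J" for i
    using assms(2) that by (intro within_steps_Image_subset) auto
  have half: "card J < 2 * card (?ball i)" if "i \<in> J" for i
  proof -
    have "card J > 0" using that assms(1) card_gt_0_iff by blast
    then show ?thesis using expanding_ball_card[OF assms(1-4) that, of r] radius by linarith
  qed
  have "?ball i \<inter> ?ball j \<noteq> {}"
  proof
    assume "?ball i \<inter> ?ball j = {}"
    then have "card (?ball i) + card (?ball j) = card (?ball i \<union> ?ball j)"
      using finite_subset[OF ball_subset assms(1)] ij by (subst card_Un_disjoint) auto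
    also have "\<dots> \<le> card J" using ball_subset ij assms(1) by (intro card_mono) auto
    finally show False using half[OF ij(1)] half[OF ij(2)] by linarith
  qed
  then show ?thesis using that by auto
qed

lemma within_steps_lift:
  assumes fibre: "\<And>x y. x \<in> V \<Longrightarrow> y \<in> V \<Longrightarrow> \<pi> x = \<pi> y \<Longrightarrow> (x, y) \<in> within_steps R D"
    and "R \<subseteq> V \<times> V" "x \<in> V" "y \<in> V" "(\<pi> x, \<pi> y) \<in> within_steps (quotient_rel \<pi> R) k"
  shows "(x, y) \<in> within_steps R (k * (D + 1) + D)"
  using assms(4,5)
proof (induction k arbitrary: y)
  case 0
  then show ?case using fibre assms(3) by simp
next
  case (Suc k)
  then obtain j where j: "(\<pi> x, j) \<in> within_steps (quotient_rel \<pi> R) k"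
    "(j, \<pi> y) \<in> (quotient_rel \<pi> R)\<^sup>="
    unfolding within_steps_Suc by (elim relcompEpair)
  from j(2) show ?case unfolding Un_iff pair_in_Id_conv
  proof
    assume "(j, \<pi> y) \<in> quotient_rel \<pi> R"
    then obtain u v where uv: "(u, v) \<in> R" "j = \<pi> u" "\<pi> y = \<pi> v" by (rule quotient_relE)
    then have "u \<in> V" "v \<in> V" using assms(2) by auto
    then have "(x, u) \<in> within_steps R (k * (D + 1) + D)" "(v, y) \<in> within_steps R D"
      using Suc j(1) uv fibre by auto
    then have "(x, y) \<in> within_steps R (k * (D + 1) + D + 1 + D)"
      by (rule within_steps_trans[OF within_steps_trans[OF _ within_steps_step[OF uv(1)]]])
    then show ?thesis by (simp add: algebra_simps)
  next
    assume "j = \<pi> y"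
    then have "(x, y) \<in> within_steps R (k * (D + 1) + D)" using Suc j(1) by simp
    then show ?thesis by (rule within_steps_mono) simp
  qed
qed

lemma graph_diam_le_of_expanding:
  assumes "finite V" "V \<noteq> {}" "\<eta> > 0" "F \<subseteq> E"
    and "expanding (\<pi> ` V) \<eta> (quotient_rel \<pi> (edge_rel V F))"
    and fibre: "\<And>x y. x \<in> V \<Longrightarrow> y \<in> V \<Longrightarrow> \<pi> x = \<pi> y \<Longrightarrow> (x, y) \<in> within_steps (edge_rel V E) D"
    and radius: "real (card (\<pi> ` V)) \<le> (1 + \<eta>) ^ r"
  shows "graph_diam V E \<le> 2 * (r * (D + 1) + D)"
proof (rule graph_diam_le[OF assms(1,2)])
  let ?R = "edge_rel V E"
  let ?A = "quotient_rel \<pi> ?R"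
  note A_subset = quotient_edge_rel_subset[of \<pi> V E]
  have A_expanding: "expanding (\<pi> ` V) \<eta> ?A"
    using assms(5) quotient_rel_mono[OF edge_rel_mono[OF assms(4)]] A_subset
      finite_imageI[OF assms(1)]
    by (rule expanding_mono)
  fix x y assume xy: "x \<in> V" "y \<in> V"
  obtain k where k: "(\<pi> x, k) \<in> within_steps ?A r" "(\<pi> y, k) \<in> within_steps ?A r"
    using expanding_balls_meet[OF _ A_subset assms(3) A_expanding radius, of "\<pi> x" "\<pi> y"]
      assms(1) xy by auto
  have "k \<in> \<pi> ` V"
    using within_steps_Image_subset[OF A_subset, of "{\<pi> x}" r] k(1) xy(1) by auto
  then obtain z where z: "z \<in> V" "k = \<pi> z" by auto
  have "(x, z) \<in> within_steps ?R (r * (D + 1) + D)" "(y, z) \<in> within_steps ?R (r * (D + 1) + D)"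
    using within_steps_lift[OF fibre edge_rel_subset] xy z k by auto
  then have "(x, y) \<in> within_steps ?R (r * (D + 1) + D + (r * (D + 1) + D))"
    by (rule within_steps_trans[OF _ within_steps_sym[OF sym_edge_rel]])
  then show "(x, y) \<in> within_steps ?R (2 * (r * (D + 1) + D))" by (simp only: mult_2)
qed

section \<open>Random subsets\<close>

definition bernoulli_subset_pmf :: "'a set \<Rightarrow> real \<Rightarrow> 'a set pmf" where
  "bernoulli_subset_pmf P p =
     map_pmf (\<lambda>f. {e \<in> P. f e}) (Pi_pmf P False (\<lambda>_. bernoulli_pmf p))"

lemma prob_bernoulli_subset_disjoint:
  assumes "finite P" "A \<subseteq> P" "0 \<le> p" "p \<le> 1"
  shows "measure_pmf.prob (bernoulli_subset_pmf P p) {F. F \<inter> A = {}} = (1 - p) ^ card A"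
proof -
  have "{f. {e \<in> P. f e} \<inter> A = {}} = Pi P (\<lambda>e. if e \<in> A then {False} else UNIV)"
    using assms(2) by (auto simp: Pi_def split: if_splits)
  then have "measure_pmf.prob (bernoulli_subset_pmf P p) {F. F \<inter> A = {}} =
      (\<Prod>e\<in>P. measure_pmf.prob (bernoulli_pmf p) (if e \<in> A then {False} else UNIV))"
    unfolding bernoulli_subset_pmf_def measure_map_pmf vimage_def
    using measure_Pi_pmf_Pi[OF assms(1)] by simp
  also have "\<dots> = (\<Prod>e\<in>P. if e \<in> A then 1 - p else 1)"
    using assms(3,4) by (intro prod.cong) (auto simp: measure_pmf_single)
  also have "\<dots> = (\<Prod>e\<in>P \<inter> A. 1 - p)"
    using assms(1) by (rule prod.inter_restrict[symmetric])
  also have "P \<inter> A = A" using assms(2) by auto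
  finally show ?thesis by simp
qed

lemma prob_bernoulli_subset_disjoint_le:
  assumes "finite P" "A \<subseteq> P" "0 \<le> p" "p \<le> 1" "h \<le> real (card A)"
  shows "measure_pmf.prob (bernoulli_subset_pmf P p) {F. F \<inter> A = {}} \<le> exp (- p * h)"
proof -
  have "(1 - p) ^ card A \<le> exp (- p) ^ card A"
    using assms(4) exp_ge_add_one_self[of "- p"] by (intro power_mono) auto
  also have "\<dots> = exp (- p * real (card A))"
    by (simp add: exp_of_nat2_mult[symmetric])
  also have "\<dots> \<le> exp (- p * h)"
    using mult_left_mono[OF assms(5,3)] by simp
  finally show ?thesis using prob_bernoulli_subset_disjoint[OF assms(1-4)] by simp
qed

lemma indep_events_bernoulli_subset_disjoint:
  assumes "finite P" "0 \<le> p" "p \<le> 1" "\<And>i. i \<in> I \<Longrightarrow> A i \<subseteq> P" "disjoint_family_on A I"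
  shows "prob_space.indep_events (bernoulli_subset_pmf P p) (\<lambda>i. {F. F \<inter> A i = {}}) I"
proof (rule prob_space.indep_eventsI[OF measure_pmf.prob_space_axioms])
  fix J assume J: "J \<subseteq> I" "finite J"
  have "(\<Inter>i\<in>J. {F. F \<inter> A i = {}}) = {F. F \<inter> (\<Union>i\<in>J. A i) = {}}" by auto
  moreover have "card (\<Union>i\<in>J. A i) = (\<Sum>i\<in>J. card (A i))"
    using J assms(1,4,5) by (intro card_UN_disjoint)
      (auto simp: disjoint_family_on_def subset_iff intro: finite_subset)
  moreover have "(\<Union>i\<in>J. A i) \<subseteq> P" using J(1) assms(4) by blast
  ultimately have "measure_pmf.prob (bernoulli_subset_pmf P p) (\<Inter>i\<in>J. {F. F \<inter> A i = {}}) =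
      (\<Prod>i\<in>J. (1 - p) ^ card (A i))"
    using assms(1-3) by (simp add: prob_bernoulli_subset_disjoint power_sum)
  also have "\<dots> = (\<Prod>i\<in>J. measure_pmf.prob (bernoulli_subset_pmf P p) {F. F \<inter> A i = {}})"
    using assms(1-4) J(1) by (intro prod.cong) (auto simp: prob_bernoulli_subset_disjoint subset_iff)
  finally show "measure_pmf.prob (bernoulli_subset_pmf P p) (\<Inter>i\<in>J. {F. F \<inter> A i = {}}) = \<dots>" .
qed simp

lemma (in prob_space) indep_events_compl:
  assumes "indep_events A I"
  shows "indep_events (\<lambda>i. space M - A i) I"
proof -
  have "indep_sets (\<lambda>i. sigma_sets (space M) {A i}) I"
    using assms unfolding indep_events_def_alt
    by (rule indep_sets_sigma) (simp add: Int_stable_def)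
  then show ?thesis
    unfolding indep_events_def_alt
    by (rule indep_sets_mono_sets) (auto intro: sigma_sets.Compl sigma_sets.Basic)
qed

lemma exp_minus_double_le:
  fixes p :: real
  assumes "0 \<le> p" "p \<le> 1 / 2"
  shows "exp (- 2 * p) \<le> 1 - p"
proof -
  have "- 2 * p \<le> - p - 2 * p\<^sup>2"
    using mult_left_mono[OF assms(2,1)] by (simp add: power2_eq_square)
  also have "\<dots> \<le> ln (1 - p)" using ln_one_minus_pos_lower_bound[OF assms] .
  finally have "exp (- 2 * p) \<le> exp (ln (1 - p))" by simp
  then show ?thesis using assms by simp
qed

lemma prob_bernoulli_subset_meets_all_le:
  assumes "finite P" "0 \<le> p" "p \<le> 1 / 2" "finite I"
    and blocks: "\<And>i. i \<in> I \<Longrightarrow> A i \<subseteq> P" "disjoint_family_on A I" "\<And>i. i \<in> I \<Longrightarrow> card (A i) \<le> N"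
  shows "measure_pmf.prob (bernoulli_subset_pmf P p) {F. \<forall>i\<in>I. F \<inter> A i \<noteq> {}} \<le>
    exp (- real (card I) * exp (- 2 * p * real N))"
proof (cases "I = {}")
  case False
  let ?M = "bernoulli_subset_pmf P p"
  have p_le_1: "p \<le> 1" using assms(3) by simp
  have "prob_space.indep_events ?M (\<lambda>i. UNIV - {F. F \<inter> A i = {}}) I"
    using prob_space.indep_events_compl[OF measure_pmf.prob_space_axioms
        indep_events_bernoulli_subset_disjoint[OF assms(1,2) p_le_1 blocks(1,2)]] by simp
  moreover have "{F. \<forall>i\<in>I. F \<inter> A i \<noteq> {}} = (\<Inter>i\<in>I. UNIV - {F. F \<inter> A i = {}})" by auto
  ultimately have "measure_pmf.prob ?M {F. \<forall>i\<in>I. F \<inter> A i \<noteq> {}} =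
      (\<Prod>i\<in>I. measure_pmf.prob ?M (UNIV - {F. F \<inter> A i = {}}))"
    using False assms(4)
    by (simp add: prob_space.indep_events_def[OF measure_pmf.prob_space_axioms])
  also have "\<dots> = (\<Prod>i\<in>I. 1 - (1 - p) ^ card (A i))"
    using measure_pmf.prob_compl[of _ ?M]
      prob_bernoulli_subset_disjoint[OF assms(1) blocks(1) assms(2) p_le_1]
    by (intro prod.cong) auto
  also have "\<dots> \<le> (\<Prod>i\<in>I. exp (- exp (- 2 * p * real N)))"
  proof (rule prod_mono)
    fix i assume "i \<in> I"
    then have "(1 - p) ^ N \<le> (1 - p) ^ card (A i)"
      using assms(2) p_le_1 blocks(3) by (intro power_decreasing) auto
    moreover have "exp (- 2 * p * real N) \<le> (1 - p) ^ N"
      using power_mono[OF exp_minus_double_le[OF assms(2,3)], of N]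
      by (simp add: exp_of_nat2_mult[symmetric])
    moreover have "1 - exp (- 2 * p * real N) \<le> exp (- exp (- 2 * p * real N))"
      using exp_ge_add_one_self[of "- exp (- 2 * p * real N)"] by simp
    moreover have "(1 - p) ^ card (A i) \<le> 1" using assms(2) p_le_1 by (intro power_le_one) auto
    ultimately show "0 \<le> 1 - (1 - p) ^ card (A i) \<and>
        1 - (1 - p) ^ card (A i) \<le> exp (- exp (- 2 * p * real N))"
      by linarith
  qed
  also have "\<dots> = exp (- real (card I) * exp (- 2 * p * real N))"
    by (simp add: exp_of_nat_mult[symmetric])
  finally show ?thesis .
qed simp

lemma prob_UN_le_of_power:
  assumes "K \<subseteq> {1..N}" "\<And>k. k \<in> K \<Longrightarrow> measure_pmf.prob M (B k) \<le> y ^ k" "0 \<le> y"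
  shows "measure_pmf.prob M (\<Union>k\<in>K. B k) \<le> real N * y"
proof (cases "K = {} \<or> y \<le> 1")
  case True
  have finite_K: "finite K" using assms(1) finite_subset by blast
  have "measure_pmf.prob M (\<Union>k\<in>K. B k) \<le> (\<Sum>k\<in>K. measure_pmf.prob M (B k))"
    using finite_K by (intro measure_pmf.finite_measure_subadditive_finite) auto
  also have "\<dots> \<le> (\<Sum>k\<in>K. y)"
  proof (rule sum_mono)
    fix k assume k: "k \<in> K"
    have "measure_pmf.prob M (B k) \<le> y ^ k" using assms(2) k .
    also have "\<dots> \<le> y ^ 1" using True k assms(1,3) by (intro power_decreasing) auto
    finally show "measure_pmf.prob M (B k) \<le> y" by simp
  qed
  also have "\<dots> \<le> (\<Sum>k\<in>{1..N}. y)" using assms(1,3) by (intro sum_mono2) auto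
  finally show ?thesis by simp
next
  case False
  then have "1 * 1 \<le> real N * y" using assms(1) by (intro mult_mono) auto
  then show ?thesis by (simp add: order_trans[OF measure_pmf.prob_le_1])
qed

section \<open>Events of asymptotic probability one\<close>

definition whp :: "(nat \<Rightarrow> 'a pmf) \<Rightarrow> (nat \<Rightarrow> 'a \<Rightarrow> bool) \<Rightarrow> bool" where
  "whp M Q \<longleftrightarrow> (\<lambda>n. measure_pmf.prob (M n) {x. Q n x}) \<longlonglongrightarrow> 1"

lemma whpI:
  assumes "\<forall>\<^sub>F n in sequentially. measure_pmf.prob (M n) {x. \<not> Q n x} \<le> \<epsilon> n" "\<epsilon> \<longlonglongrightarrow> 0"
  shows "whp M Q"
  unfolding whp_def
proof (rule tendsto_sandwich[of "\<lambda>n. 1 - \<epsilon> n" _ _ "\<lambda>_. 1"])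
  have "{x. Q n x} = UNIV - {x. \<not> Q n x}" for n by auto
  then have "measure_pmf.prob (M n) {x. Q n x} = 1 - measure_pmf.prob (M n) {x. \<not> Q n x}" for n
    using measure_pmf.prob_compl[of "{x. \<not> Q n x}" "M n"] by simp
  then show "\<forall>\<^sub>F n in sequentially. 1 - \<epsilon> n \<le> measure_pmf.prob (M n) {x. Q n x}"
    using assms(1) by simp
  show "(\<lambda>n. 1 - \<epsilon> n) \<longlonglongrightarrow> 1" using tendsto_diff[OF tendsto_const assms(2), of 1] by simp
qed auto

lemma whp_mono:
  assumes "whp M Q" "\<forall>\<^sub>F n in sequentially. \<forall>x. Q n x \<longrightarrow> Q' n x"
  shows "whp M Q'"
  unfolding whp_def
proof (rule tendsto_sandwich[OF _ _ assms(1)[unfolded whp_def]])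
  show "\<forall>\<^sub>F n in sequentially.
      measure_pmf.prob (M n) {x. Q n x} \<le> measure_pmf.prob (M n) {x. Q' n x}"
    using assms(2) by eventually_elim (auto intro!: measure_pmf.finite_measure_mono)
qed auto

section \<open>Expansion of random coarse-grained graphs\<close>

definition neighbours :: "'v set \<Rightarrow> 'v set set \<Rightarrow> 'v \<Rightarrow> 'v set" where
  "neighbours V E u = {v \<in> V. {u, v} \<in> E}"

definition crossing_pairs :: "'v set set \<Rightarrow> 'v set \<Rightarrow> 'v set \<Rightarrow> 'v set set" where
  "crossing_pairs P X Y = {e \<in> P. \<exists>x\<in>X. \<exists>y\<in>Y. e = {x, y}}"

lemma card_crossing_pairs_ge:
  assumes "finite P" "finite X" "finite Y" "X \<inter> Y = {}"
    and degree: "\<And>x. x \<in> X \<Longrightarrow> h \<le> real (card (neighbours Y P x))"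
  shows "real (card X) * h \<le> real (card (crossing_pairs P X Y))"
proof -
  define Z where "Z = (SIGMA x:X. neighbours Y P x)"
  have "inj_on (\<lambda>(x, y). {x, y}) Z"
    using assms(4) by (auto simp: Z_def neighbours_def inj_on_def doubleton_eq_iff)
  moreover have "(\<lambda>(x, y). {x, y}) ` Z \<subseteq> crossing_pairs P X Y"
    by (auto simp: Z_def neighbours_def crossing_pairs_def)
  moreover have "finite (crossing_pairs P X Y)" using assms(1) by (simp add: crossing_pairs_def)
  ultimately have "card Z \<le> card (crossing_pairs P X Y)"
    using card_image card_mono by metis
  moreover have "real (card X) * h \<le> (\<Sum>x\<in>X. real (card (neighbours Y P x)))"
    using sum_mono[OF degree, of X] by simp
  moreover have "real (card Z) = (\<Sum>x\<in>X. real (card (neighbours Y P x)))"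
    unfolding Z_def using assms(2,3) by (subst card_SigmaI) (auto simp: neighbours_def)
  ultimately show ?thesis by linarith
qed

lemma card_nested_subsets_le:
  assumes "finite J"
  shows "card {(S, W). S \<subseteq> W \<and> W \<subseteq> J \<and> card S = k \<and> card W = l} \<le> card J ^ (k + l)"
proof -
  have choose_le: "card J choose i \<le> card J ^ i" for i
    by (cases "i \<le> card J") (auto simp: binomial_le_pow binomial_eq_0)
  have "card {(S, W). S \<subseteq> W \<and> W \<subseteq> J \<and> card S = k \<and> card W = l} \<le>
      card ({S. S \<subseteq> J \<and> card S = k} \<times> {W. W \<subseteq> J \<and> card W = l})"
    using assms by (intro card_mono) auto
  also have "\<dots> = (card J choose k) * (card J choose l)"
    using assms by (simp add: card_cartesian_product n_subsets)
  also have "\<dots> \<le> card J ^ k * card J ^ l"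
    using choose_le by (intro mult_le_mono)
  finally show ?thesis by (simp add: power_add)
qed

locale dense_coarse_graining =
  fixes V :: "'v set" and P :: "'v set set" and \<pi> :: "'v \<Rightarrow> 'j" and N :: nat and \<eta> :: real
  assumes finite_V: "finite V" and finite_P: "finite P"
    and eta_pos: "0 < \<eta>" and eta_le_1: "\<eta> \<le> 1"
    and degree: "\<And>u. u \<in> V \<Longrightarrow> (1 / 2 + 3 * \<eta>) * real (card V) \<le> real (card (neighbours V P u))"
    and fibre_card: "\<And>j. j \<in> \<pi> ` V \<Longrightarrow> N \<le> card (V \<inter> \<pi> -` {j})"
    and coverage: "(1 - \<eta>) * real (card V) \<le> real (card (\<pi> ` V) * N)"
begin

lemma card_fibres_ge:
  assumes "T \<subseteq> \<pi> ` V"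
  shows "card T * N \<le> card (V \<inter> \<pi> -` T)"
proof -
  have finite_T: "finite T" using assms finite_V finite_surj by blast
  have "card T * N = (\<Sum>j\<in>T. N)" by simp
  also have "\<dots> \<le> (\<Sum>j\<in>T. card (V \<inter> \<pi> -` {j}))"
    using assms fibre_card by (intro sum_mono) auto
  also have "\<dots> = card (\<Union>j\<in>T. V \<inter> \<pi> -` {j})"
    using finite_T finite_V by (intro card_UN_disjoint[symmetric]) auto
  also have "(\<Union>j\<in>T. V \<inter> \<pi> -` {j}) = V \<inter> \<pi> -` T" by auto
  finally show ?thesis .
qed

lemma degree_outside_ge:
  assumes "W \<subseteq> \<pi> ` V" "2 * real (card W) \<le> (1 + \<eta>) * real (card (\<pi> ` V))" "u \<in> V"
  shows "\<eta> * real (card V) \<le> real (card (neighbours (V \<inter> \<pi> -` (\<pi> ` V - W)) P u))"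
proof -
  define Y where "Y = V \<inter> \<pi> -` (\<pi> ` V - W)"
  have finite_sets: "finite Y" "finite W" "finite (\<pi> ` V)"
    using finite_V finite_surj[OF _ assms(1)] by (auto simp: Y_def)
  have "card (neighbours V P u) \<le> card (neighbours Y P u \<union> (V - Y))"
    using finite_sets(1) finite_V by (intro card_mono) (auto simp: neighbours_def)
  also have "\<dots> \<le> card (neighbours Y P u) + card (V - Y)" by (rule card_Un_le)
  also have "card (V - Y) = card V - card Y"
    using finite_sets(1) by (intro card_Diff_subset) (auto simp: Y_def)
  finally have degree_le: "real (card (neighbours V P u)) \<le>
      real (card (neighbours Y P u)) + (real (card V) - real (card Y))"
    using card_mono[OF finite_V, of Y] by (simp add: Y_def)
  have "(card (\<pi> ` V) - card W) * N \<le> card Y"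
    using card_fibres_ge[of "\<pi> ` V - W"] finite_sets assms(1) by (simp add: Y_def card_Diff_subset)
  then have "real ((card (\<pi> ` V) - card W) * N) \<le> real (card Y)" by (rule of_nat_mono)
  then have Y_ge: "real (card (\<pi> ` V) * N) - real (card W * N) \<le> real (card Y)"
    using card_mono[OF finite_sets(3) assms(1)] by (simp add: of_nat_diff algebra_simps)
  have "V \<inter> \<pi> -` \<pi> ` V = V" by auto
  then have "real (card (\<pi> ` V) * N) \<le> real (card V)"
    using card_fibres_ge[of "\<pi> ` V"] by (simp del: of_nat_mult)
  then have "(1 + \<eta>) * real (card (\<pi> ` V) * N) \<le> (1 + \<eta>) * real (card V)"
    using eta_pos by (intro mult_left_mono) auto
  moreover have "2 * real (card W) * real N \<le> (1 + \<eta>) * real (card (\<pi> ` V)) * real N"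
    using assms(2) by (intro mult_right_mono) auto
  ultimately have W_le: "2 * real (card W * N) \<le> (1 + \<eta>) * real (card V)" by simp
  have "0 \<le> \<eta> * real (card V)" using eta_pos by simp
  then have "\<eta> * real (card V) \<le> real (card (neighbours Y P u))"
    using degree_le Y_ge W_le degree[OF assms(3)] coverage by (simp add: algebra_simps)
  then show ?thesis unfolding Y_def .
qed

definition confined :: "'v set set \<Rightarrow> 'j set \<Rightarrow> 'j set \<Rightarrow> bool" where
  "confined F S W \<longleftrightarrow> S \<subseteq> W \<and> W \<subseteq> \<pi> ` V \<and>
     F \<inter> crossing_pairs P (V \<inter> \<pi> -` S) (V \<inter> \<pi> -` (\<pi> ` V - W)) = {}"

lemma not_expanding_confined:
  assumes "\<not> expanding (\<pi> ` V) \<eta> (quotient_rel \<pi> (edge_rel V F))"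
  obtains S W where "confined F S W" "S \<noteq> {}" "2 * card S \<le> card (\<pi> ` V)"
    "card W = nat \<lfloor>(1 + \<eta>) * real (card S)\<rfloor>"
proof -
  let ?J = "\<pi> ` V" and ?A = "quotient_rel \<pi> (edge_rel V F)"
  obtain S where S: "S \<subseteq> ?J" "S \<noteq> {}" "2 * card S \<le> card ?J"
    and small: "real (card (S \<union> ?A `` S)) < (1 + \<eta>) * real (card S)"
    using assms unfolding expanding_def by (auto simp: not_le)
  have "(1 + \<eta>) * real (card S) \<le> 2 * real (card S)"
    using eta_le_1 by (intro mult_right_mono) auto
  then have w_bounds: "card (S \<union> ?A `` S) \<le> nat \<lfloor>(1 + \<eta>) * real (card S)\<rfloor>"
    "nat \<lfloor>(1 + \<eta>) * real (card S)\<rfloor> \<le> card ?J"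
    using small S(3) by linarith+
  \<comment> \<open>Enlarging \<open>S\<close> and its neighbours to a size that depends only on \<open>card S\<close> makes the sets in
    the union bound easy to count.\<close>
  have "S \<union> ?A `` S \<subseteq> ?J" using S(1) quotient_edge_rel_subset[of \<pi> V F] by blast
  then obtain W where W: "S \<union> ?A `` S \<subseteq> W" "W \<subseteq> ?J" "card W = nat \<lfloor>(1 + \<eta>) * real (card S)\<rfloor>"
    using exists_subset_between[OF w_bounds _ finite_imageI[OF finite_V]] by blast
  have "F \<inter> crossing_pairs P (V \<inter> \<pi> -` S) (V \<inter> \<pi> -` (?J - W)) = {}"
  proof (rule ccontr)
    assume "F \<inter> crossing_pairs P (V \<inter> \<pi> -` S) (V \<inter> \<pi> -` (?J - W)) \<noteq> {}"
    then obtain x y where xy: "{x, y} \<in> F" "x \<in> V" "\<pi> x \<in> S" "y \<in> V" "\<pi> y \<notin> W"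
      by (auto simp: crossing_pairs_def)
    then have "(x, y) \<in> edge_rel V F" by (simp add: edge_rel_def)
    then have "(\<pi> x, \<pi> y) \<in> ?A" by (rule quotient_relI)
    then have "\<pi> y \<in> ?A `` S" using xy(3) by (rule ImageI)
    then show False using xy(5) subsetD[OF W(1) UnI2] by metis
  qed
  then have "confined F S W" using W(1,2) by (simp add: confined_def)
  then show ?thesis using that S(2,3) W(3) by blast
qed

lemma prob_confined_le:
  assumes p_bounds: "0 \<le> p" "p \<le> 1"
    and sizes: "2 * card S \<le> card (\<pi> ` V)" "real (card W) \<le> (1 + \<eta>) * real (card S)"
  shows "measure_pmf.prob (bernoulli_subset_pmf P p) {F. confined F S W} \<le>
    exp (- p * real N * \<eta> * real (card V)) ^ card S"
proof (cases "S \<subseteq> W \<and> W \<subseteq> \<pi> ` V")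
  case True
  define X Y where "X = V \<inter> \<pi> -` S" and "Y = V \<inter> \<pi> -` (\<pi> ` V - W)"
  have "2 * real (card W) \<le> (1 + \<eta>) * real (2 * card S)" using sizes(2) by simp
  also have "\<dots> \<le> (1 + \<eta>) * real (card (\<pi> ` V))"
    using sizes(1) eta_pos by (intro mult_left_mono of_nat_mono) auto
  finally have degree_Y: "\<eta> * real (card V) \<le> real (card (neighbours Y P u))" if "u \<in> X" for u
    using degree_outside_ge[of W u] that True by (simp add: X_def Y_def)
  have "card S * N \<le> card X"
    unfolding X_def using True by (intro card_fibres_ge) auto
  then have "real (card S * N) * (\<eta> * real (card V)) \<le> real (card X) * (\<eta> * real (card V))"
    using eta_pos by (intro mult_right_mono of_nat_mono) auto
  also have "\<dots> \<le> real (card (crossing_pairs P X Y))"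
    using finite_V True by (intro card_crossing_pairs_ge finite_P degree_Y) (auto simp: X_def Y_def)
  finally have "measure_pmf.prob (bernoulli_subset_pmf P p) {F. F \<inter> crossing_pairs P X Y = {}} \<le>
      exp (- p * (real (card S * N) * (\<eta> * real (card V))))"
    using p_bounds finite_P by (intro prob_bernoulli_subset_disjoint_le) (auto simp: crossing_pairs_def)
  also have "\<dots> = exp (- p * real N * \<eta> * real (card V)) ^ card S"
    by (simp add: exp_of_nat_mult[symmetric] algebra_simps)
  finally show ?thesis using True by (simp add: confined_def X_def Y_def)
next
  case False
  then have "{F. confined F S W} = {}" by (auto simp: confined_def)
  then show ?thesis by simp
qed

lemma prob_ex_confined_le:
  assumes p_bounds: "0 \<le> p" "p \<le> 1" and "V \<noteq> {}" and half: "2 * k \<le> card (\<pi> ` V)"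
  shows "measure_pmf.prob (bernoulli_subset_pmf P p)
      {F. \<exists>S W. confined F S W \<and> card S = k \<and> card W = nat \<lfloor>(1 + \<eta>) * real k\<rfloor>} \<le>
    (real (card (\<pi> ` V)) ^ 3 * exp (- p * real N * \<eta> * real (card V))) ^ k"
proof -
  define J M where "J = \<pi> ` V" and "M = bernoulli_subset_pmf P p"
  define x where "x = exp (- p * real N * \<eta> * real (card V))"
  define w where "w = nat \<lfloor>(1 + \<eta>) * real k\<rfloor>"
  define I where "I = {(S, W). S \<subseteq> W \<and> W \<subseteq> J \<and> card S = k \<and> card W = w}"
  have J_finite: "finite J" and J_nonempty: "1 \<le> card J"
    using finite_V assms(3) by (auto simp: J_def Suc_le_eq card_gt_0_iff)
  have finite_I: "finite I"
    by (rule finite_subset[of _ "Pow J \<times> Pow J"]) (use J_finite in \<open>auto simp: I_def\<close>)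
  have w_le: "real w \<le> (1 + \<eta>) * real k" using eta_pos by (simp add: w_def)
  also have "\<dots> \<le> 2 * real k" using eta_le_1 by (intro mult_right_mono) auto
  finally have "k + w \<le> 3 * k" by linarith
  then have "card J ^ (k + w) \<le> card J ^ (3 * k)" using J_nonempty by (intro power_increasing)
  then have card_I: "card I \<le> card J ^ (3 * k)"
    using card_nested_subsets_le[OF J_finite, of k w] unfolding I_def by linarith
  have "{F. \<exists>S W. confined F S W \<and> card S = k \<and> card W = w} =
      (\<Union>(S, W)\<in>I. {F. confined F S W})"
    by (auto simp: I_def confined_def J_def)
  then have "measure_pmf.prob M {F. \<exists>S W. confined F S W \<and> card S = k \<and> card W = w} \<le>
      (\<Sum>z\<in>I. measure_pmf.prob M (case z of (S, W) \<Rightarrow> {F. confined F S W}))"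
    using measure_pmf.finite_measure_subadditive_finite[OF finite_I] by simp
  also have "\<dots> \<le> (\<Sum>z\<in>I. x ^ k)"
    using prob_confined_le[OF p_bounds] half w_le
    by (intro sum_mono) (auto simp: I_def M_def x_def J_def)
  also have "\<dots> \<le> real (card J ^ (3 * k)) * x ^ k"
    using of_nat_mono[OF card_I] by (auto simp: x_def intro!: mult_right_mono simp del: of_nat_power)
  also have "\<dots> = (real (card J) ^ 3 * x) ^ k" by (simp add: power_mult_distrib power_mult)
  finally show ?thesis unfolding J_def M_def x_def w_def .
qed

lemma prob_not_expanding_le:
  assumes p_bounds: "0 \<le> p" "p \<le> 1" and "V \<noteq> {}"
  shows "measure_pmf.prob (bernoulli_subset_pmf P p)
      {F. \<not> expanding (\<pi> ` V) \<eta> (quotient_rel \<pi> (edge_rel V F))} \<le>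
    real (card (\<pi> ` V)) ^ 4 * exp (- p * real N * \<eta> * real (card V))"
proof -
  define J M where "J = \<pi> ` V" and "M = bernoulli_subset_pmf P p"
  define y where "y = real (card J) ^ 3 * exp (- p * real N * \<eta> * real (card V))"
  define B where
    "B k = {F. \<exists>S W. confined F S W \<and> card S = k \<and> card W = nat \<lfloor>(1 + \<eta>) * real k\<rfloor>}" for k
  let ?K = "{k \<in> {1..card J}. 2 * k \<le> card J}"
  have finite_J: "finite J" using finite_V by (simp add: J_def)
  have "{F. \<not> expanding J \<eta> (quotient_rel \<pi> (edge_rel V F))} \<subseteq> (\<Union>k\<in>?K. B k)"
  proof
    fix F assume "F \<in> {F. \<not> expanding J \<eta> (quotient_rel \<pi> (edge_rel V F))}"
    then obtain S W where SW: "confined F S W" "S \<noteq> {}" "2 * card S \<le> card J"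
      "card W = nat \<lfloor>(1 + \<eta>) * real (card S)\<rfloor>"
      unfolding J_def mem_Collect_eq by (elim not_expanding_confined)
    then have "S \<subseteq> J" unfolding confined_def J_def by blast
    then have "finite S" using finite_J by (rule finite_subset)
    then have "card S \<in> ?K" using SW(2,3) by (auto simp: Suc_le_eq card_gt_0_iff)
    moreover have "F \<in> B (card S)" using SW by (auto simp: B_def)
    ultimately show "F \<in> (\<Union>k\<in>?K. B k)" by blast
  qed
  then have "measure_pmf.prob M {F. \<not> expanding J \<eta> (quotient_rel \<pi> (edge_rel V F))} \<le>
      measure_pmf.prob M (\<Union>k\<in>?K. B k)"
    by (intro measure_pmf.finite_measure_mono) auto
  also have "\<dots> \<le> real (card J) * y"
  proof (rule prob_UN_le_of_power)
    show "measure_pmf.prob M (B k) \<le> y ^ k" if "k \<in> ?K" for k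
      using prob_ex_confined_le[OF assms, of k] that by (simp add: B_def M_def J_def y_def)
  qed (auto simp: y_def)
  finally show ?thesis by (simp add: J_def M_def y_def power_numeral_reduce mult_ac)
qed

end

section \<open>Geometry of the torus\<close>

lemma finite_torus_verts: "finite (torus_verts d n)"
  unfolding torus_verts_def by (intro finite_PiE) auto

lemma card_torus_verts: "card (torus_verts d n) = n ^ d"
  unfolding torus_verts_def by (simp add: card_PiE)

lemma torus_verts_less: "x \<in> torus_verts d n \<Longrightarrow> s < d \<Longrightarrow> x s < n"
  unfolding torus_verts_def by auto

lemma torus_verts_upd: "x \<in> torus_verts d n \<Longrightarrow> s < d \<Longrightarrow> a < n \<Longrightarrow> x(s := a) \<in> torus_verts d n"
  unfolding torus_verts_def by (auto simp: PiE_iff extensional_def)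

lemma torus_edge_Suc:
  assumes "x \<in> torus_verts d n" "s < d" "Suc (x s) < n" "torus_edges d n \<subseteq> E"
  shows "(x, x(s := Suc (x s))) \<in> edge_rel (torus_verts d n) E"
proof -
  have "{x, x(s := (x s + 1) mod n)} \<in> torus_edges d n"
    unfolding torus_edges_def using assms(1,2) by blast
  then have "{x, x(s := Suc (x s))} \<in> E" using assms(3,4) by auto
  then show ?thesis
    using assms torus_verts_upd[OF assms(1-3)] by (auto simp: edge_rel_def)
qed

lemma within_steps_torus_add:
  assumes "x \<in> torus_verts d n" "s < d" "x s + k < n" "torus_edges d n \<subseteq> E"
  shows "(x, x(s := x s + k)) \<in> within_steps (edge_rel (torus_verts d n) E) k"
  using assms(3)
proof (induction k)
  case (Suc k)
  let ?z = "x(s := x s + k)"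
  have "?z \<in> torus_verts d n" using Suc.prems by (intro torus_verts_upd assms(1,2)) simp
  then have "(?z, ?z(s := Suc (?z s))) \<in> edge_rel (torus_verts d n) E"
    using Suc.prems by (intro torus_edge_Suc assms(2,4)) auto
  then have "(?z, x(s := x s + Suc k)) \<in> edge_rel (torus_verts d n) E" by simp
  moreover have "(x, ?z) \<in> within_steps (edge_rel (torus_verts d n) E) k"
    by (rule Suc.IH) (use Suc.prems in simp)
  ultimately have "(x, x(s := x s + Suc k)) \<in> within_steps (edge_rel (torus_verts d n) E) (k + 1)"
    by (intro within_steps_trans[OF _ within_steps_step])
  then show ?case unfolding Suc_eq_plus1 .
qed simp

lemma within_steps_torus_upd:
  assumes "x \<in> torus_verts d n" "s < d" "b < n" "torus_edges d n \<subseteq> E"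
  shows "(x, x(s := b)) \<in> within_steps (edge_rel (torus_verts d n) E) (nat \<bar>int (x s) - int b\<bar>)"
proof (cases "x s \<le> b")
  case True
  then show ?thesis
    using within_steps_torus_add[OF assms(1,2) _ assms(4), of "b - x s"] assms(3)
    by (simp add: nat_diff_distrib' abs_of_nonpos flip: of_nat_diff)
next
  case False
  moreover have "x s < n" using assms(1,2) by (rule torus_verts_less)
  ultimately have "(x(s := b), x) \<in> within_steps (edge_rel (torus_verts d n) E) (x s - b)"
    using within_steps_torus_add[OF torus_verts_upd[OF assms(1-3)] assms(2) _ assms(4), of "x s - b"]
    by simp
  moreover have "nat \<bar>int (x s) - int b\<bar> = x s - b" using False by simp
  ultimately show ?thesis using within_steps_sym[OF sym_edge_rel] by metis
qed

lemma within_steps_torus: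
  assumes "x \<in> torus_verts d n" "y \<in> torus_verts d n" "torus_edges d n \<subseteq> E"
    and close: "\<And>s. s < d \<Longrightarrow> \<bar>int (x s) - int (y s)\<bar> \<le> int L"
  shows "(x, y) \<in> within_steps (edge_rel (torus_verts d n) E) (d * L)"
proof -
  define z where "z k = (\<lambda>s. if s < k then y s else x s)" for k
  have z_verts: "z k \<in> torus_verts d n" for k
    using assms(1,2) by (auto simp: z_def torus_verts_def PiE_iff extensional_def)
  have "k \<le> d \<Longrightarrow> (x, z k) \<in> within_steps (edge_rel (torus_verts d n) E) (k * L)" for k
  proof (induction k)
    case 0
    then show ?case by (simp add: z_def)
  next
    case (Suc k)
    have "z (Suc k) = (z k)(k := y k)" by (auto simp: z_def less_Suc_eq)
    moreover have "(z k, (z k)(k := y k)) \<in>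
        within_steps (edge_rel (torus_verts d n) E) (nat \<bar>int (z k k) - int (y k)\<bar>)"
      using Suc.prems assms(2) torus_verts_less
      by (intro within_steps_torus_upd z_verts assms(3)) auto
    then have "(z k, (z k)(k := y k)) \<in> within_steps (edge_rel (torus_verts d n) E) L"
      by (rule within_steps_mono) (use close[of k] Suc.prems in \<open>simp add: z_def\<close>)
    ultimately have "(x, z (Suc k)) \<in> within_steps (edge_rel (torus_verts d n) E) (k * L + L)"
      using Suc within_steps_trans by simp
    then show ?case by (simp add: add.commute)
  qed
  moreover have "z d = y"
    using assms(1,2) by (auto simp: z_def torus_verts_def PiE_def extensional_def fun_eq_iff)
  ultimately show ?thesis by (metis order_refl)
qed

definition circle_dist :: "nat \<Rightarrow> nat \<Rightarrow> nat \<Rightarrow> int" where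
  "circle_dist n a b = min \<bar>int a - int b\<bar> (int n - \<bar>int a - int b\<bar>)"

lemma circle_dist_triangle:
  assumes "a < n" "b < n" "c < n"
  shows "circle_dist n a c \<le> circle_dist n a b + circle_dist n b c"
  using assms unfolding circle_dist_def by linarith

lemma circle_dist_add_mod:
  assumes "a < n" "k \<le> n"
  shows "circle_dist n a ((a + k) mod n) = int (min k (n - k))"
proof (cases "a + k < n")
  case True
  then show ?thesis using assms by (auto simp: circle_dist_def of_nat_diff min_def)
next
  case False
  then have "(a + k) mod n = a + k - n" using assms by (simp add: mod_if)
  then show ?thesis using False assms by (auto simp: circle_dist_def of_nat_diff min_def)
qed

lemma card_circle_ball:
  assumes "a < n" "2 * t + 1 \<le> n"
  shows "card {b. b < n \<and> circle_dist n a b \<le> int t} = 2 * t + 1"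
proof -
  have eq: "{b. b < n \<and> circle_dist n a b \<le> int t} =
      {a - t..min (n - 1) (a + t)} \<union> ({..<a + t + 1 - n} \<union> {a + n - t..<n})"
    using assms by (auto simp: circle_dist_def min_le_iff_disj)
  have "{..<a + t + 1 - n} \<inter> {a + n - t..<n} = {}"
    and "{a - t..min (n - 1) (a + t)} \<inter> ({..<a + t + 1 - n} \<union> {a + n - t..<n}) = {}"
    using assms by auto
  then show ?thesis
    unfolding eq using assms by (simp add: card_Un_disjoint min_def) linarith
qed

lemma torus_dist_le_iff:
  assumes "d \<ge> 1"
  shows "torus_dist d n x y \<le> k \<longleftrightarrow> (\<forall>s<d. circle_dist n (x s) (y s) \<le> k)"
proof -
  have "{..<d} \<noteq> {}" using assms by (auto simp: lessThan_empty_iff)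
  then show ?thesis
    unfolding torus_dist_def circle_dist_def by (subst Max_le_iff) auto
qed

lemma circle_dist_le_torus_dist: "s < d \<Longrightarrow> circle_dist n (x s) (y s) \<le> torus_dist d n x y"
  using torus_dist_le_iff[of d n x y "torus_dist d n x y"] by simp

lemma torus_dist_self_le: "d \<ge> 1 \<Longrightarrow> torus_dist d n x x \<le> 0"
  by (simp add: torus_dist_le_iff circle_dist_def)

lemma torus_dist_commute: "torus_dist d n x y = torus_dist d n y x"
  by (simp add: torus_dist_def abs_minus_commute)

lemma torus_dist_triangle:
  assumes "d \<ge> 1" "x \<in> torus_verts d n" "y \<in> torus_verts d n" "z \<in> torus_verts d n"
  shows "torus_dist d n x z \<le> torus_dist d n x y + torus_dist d n y z"
  unfolding torus_dist_le_iff[OF assms(1)]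
proof (intro allI impI)
  fix s assume s: "s < d"
  then have "circle_dist n (x s) (z s) \<le> circle_dist n (x s) (y s) + circle_dist n (y s) (z s)"
    using assms(2-4) by (intro circle_dist_triangle) (auto dest: torus_verts_less)
  also have "\<dots> \<le> torus_dist d n x y + torus_dist d n y z"
    using s by (intro add_mono circle_dist_le_torus_dist)
  finally show "circle_dist n (x s) (z s) \<le> torus_dist d n x y + torus_dist d n y z" .
qed

lemma torus_dist_le_of_torus_edge:
  assumes "{x, y} \<in> torus_edges d n"
  shows "torus_dist d n x y \<le> 1"
proof -
  obtain z s where z: "z \<in> torus_verts d n" "s < d" "{x, y} = {z, z(s := (z s + 1) mod n)}"
    using assms unfolding torus_edges_def by auto
  have "circle_dist n (z s) ((z s + 1) mod n) \<le> 1"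
    using circle_dist_add_mod[of "z s" n 1] torus_verts_less[OF z(1,2)] by simp
  then have "torus_dist d n z (z(s := (z s + 1) mod n)) \<le> 1"
    using z(2) by (auto simp: torus_dist_le_iff circle_dist_def)
  then show ?thesis using z(3) torus_dist_commute by (metis doubleton_eq_iff)
qed

definition torus_ball :: "nat \<Rightarrow> nat \<Rightarrow> (nat \<Rightarrow> nat) \<Rightarrow> nat \<Rightarrow> (nat \<Rightarrow> nat) set" where
  "torus_ball d n c t = {x \<in> torus_verts d n. torus_dist d n c x \<le> int t}"

lemma card_torus_ball:
  assumes "d \<ge> 1" "c \<in> torus_verts d n" "2 * t + 1 \<le> n"
  shows "card (torus_ball d n c t) = (2 * t + 1) ^ d"
proof -
  have "torus_ball d n c t = (\<Pi>\<^sub>E s\<in>{..<d}. {b. b < n \<and> circle_dist n (c s) b \<le> int t})"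
    unfolding torus_ball_def torus_verts_def torus_dist_le_iff[OF assms(1)] set_eq_iff
      mem_Collect_eq PiE_iff lessThan_iff
    by blast
  moreover have "card {b. b < n \<and> circle_dist n (c s) b \<le> int t} = 2 * t + 1" if "s < d" for s
    using torus_verts_less[OF assms(2) that] assms(3) by (rule card_circle_ball)
  ultimately show ?thesis by (simp add: card_PiE)
qed

lemma less_graph_diam_of_isolated_ball:
  assumes "d \<ge> 1" "c \<in> torus_verts d n" "2 * Suc t \<le> n"
    and isolated: "\<And>e. e \<in> F \<Longrightarrow> e \<inter> torus_ball d n c t = {}"
  shows "t < graph_diam (torus_verts d n) (torus_edges d n \<union> F)"
proof -
  define V E where "V = torus_verts d n" and "E = torus_edges d n \<union> F"
  define v where "v = c(0 := (c 0 + Suc t) mod n)"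
  have c_in_V: "c \<in> V" and v_in_V: "v \<in> V"
    using assms(1-3) by (auto simp: V_def v_def intro!: torus_verts_upd)
  have "int (Suc t) = circle_dist n (c 0) (v 0)"
    using circle_dist_add_mod[of "c 0" n "Suc t"] torus_verts_less[OF assms(2), of 0] assms(1,3)
    by (simp add: v_def)
  then have far: "int t < torus_dist d n c v"
    using circle_dist_le_torus_dist[of 0 d n c v] assms(1) by linarith
  have step: "torus_dist d n c y \<le> torus_dist d n c x + 1"
    if "(x, y) \<in> edge_rel V E" "torus_dist d n c x \<le> int t" for x y
  proof -
    have xy: "x \<in> V" "y \<in> V" "{x, y} \<in> E" using that(1) by (auto simp: edge_rel_def)
    then have "x \<in> torus_ball d n c t" using that(2) by (simp add: torus_ball_def V_def)
    then have "{x, y} \<in> torus_edges d n" using isolated xy(3) by (auto simp: E_def)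
    then show ?thesis
      using torus_dist_triangle[of d c n x y] torus_dist_le_of_torus_edge[of x y d n]
        assms(1) c_in_V xy
      unfolding V_def by linarith
  qed
  have connected: "(c, v) \<in> within_steps (edge_rel V E) (d * n)"
    unfolding V_def
  proof (rule within_steps_torus)
    show "\<bar>int (c s) - int (v s)\<bar> \<le> int n" if "s < d" for s
      using torus_verts_less[of c d n s] torus_verts_less[of v d n s] c_in_V v_in_V that
      by (auto simp: V_def)
  qed (use c_in_V v_in_V in \<open>auto simp: V_def E_def\<close>)
  have "t < graph_dist V E c v"
    using c_in_V connected torus_dist_self_le[OF assms(1)] far step
    by (rule less_graph_dist_of_potential[where f = "torus_dist d n c"])
  also have "\<dots> \<le> graph_diam V E"
    using c_in_V v_in_V finite_torus_verts unfolding V_def by (intro graph_dist_le_diam)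
  finally show ?thesis unfolding V_def E_def .
qed

section \<open>Cells of the torus\<close>

text \<open>The last cell in each direction also contains the remaining layers of width \<open>n mod L\<close>.\<close>

definition cell_index :: "nat \<Rightarrow> nat \<Rightarrow> nat \<Rightarrow> (nat \<Rightarrow> nat) \<Rightarrow> nat \<Rightarrow> nat" where
  "cell_index d m L x = restrict (\<lambda>s. min (x s div L) (m - 1)) {..<d}"

lemma cell_index_in_torus: "m \<ge> 1 \<Longrightarrow> cell_index d m L x \<in> torus_verts d m"
  by (auto simp: cell_index_def torus_verts_def)

lemma card_cell_ge:
  assumes "m * L \<le> n" "j \<in> torus_verts d m"
  shows "L ^ d \<le> card (torus_verts d n \<inter> cell_index d m L -` {j})"
proof -
  define Q where "Q = (\<Pi>\<^sub>E s\<in>{..<d}. {L * j s..<L * j s + L})"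
  have "Q \<subseteq> torus_verts d n \<inter> cell_index d m L -` {j}"
  proof
    fix x assume x: "x \<in> Q"
    have x_bounds: "L * j s \<le> x s" "x s < L * j s + L" if "s < d" for s
      using PiE_mem[OF x[unfolded Q_def], of s] that by auto
    have range: "j s < m" "x s < n" if "s < d" for s
    proof -
      show "j s < m" using assms(2) that by (rule torus_verts_less)
      then have "L * Suc (j s) \<le> L * m" by (intro mult_le_mono2) simp
      then show "x s < n" using x_bounds(2)[OF that] assms(1) by (simp add: mult.commute)
    qed
    have "x s div L = j s" if "s < d" for s
      using x_bounds[OF that] by (intro div_nat_eqI) (auto simp: mult.commute)
    then have "cell_index d m L x s = j s" for s
      using assms(2) range(1)[of s]
      by (auto simp: cell_index_def torus_verts_def PiE_def extensional_def)
    moreover have "x \<in> torus_verts d n"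
      using x range(2) by (auto simp: Q_def torus_verts_def PiE_iff)
    ultimately show "x \<in> torus_verts d n \<inter> cell_index d m L -` {j}" by (auto simp: fun_eq_iff)
  qed
  then have "card Q \<le> card (torus_verts d n \<inter> cell_index d m L -` {j})"
    using finite_torus_verts by (intro card_mono) auto
  then show ?thesis by (simp add: Q_def card_PiE)
qed

lemma cell_index_image:
  assumes "m \<ge> 1" "L \<ge> 1" "m * L \<le> n"
  shows "cell_index d m L ` torus_verts d n = torus_verts d m"
proof
  show "torus_verts d m \<subseteq> cell_index d m L ` torus_verts d n"
  proof
    fix j assume "j \<in> torus_verts d m"
    then have "L ^ d \<le> card (torus_verts d n \<inter> cell_index d m L -` {j})"
      by (rule card_cell_ge[OF assms(3)])
    then have "torus_verts d n \<inter> cell_index d m L -` {j} \<noteq> {}" using assms(2) by fastforce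
    then show "j \<in> cell_index d m L ` torus_verts d n" by auto
  qed
qed (use cell_index_in_torus[OF assms(1)] in blast)

lemma cell_layer_bounds:
  fixes a m L :: nat
  assumes "m \<ge> 1" "L > 0" "a < m * L + L"
  shows "L * min (a div L) (m - 1) \<le> a" "a < L * min (a div L) (m - 1) + 2 * L"
proof -
  have "L * min (a div L) (m - 1) \<le> a \<and> a < L * min (a div L) (m - 1) + 2 * L"
  proof (cases "a div L \<le> m - 1")
    case True
    moreover have "L * (a div L) + a mod L = a" "a mod L < L" using assms(2) by simp_all
    ultimately show ?thesis unfolding min_absorb1[OF True] by linarith
  next
    case False
    then have "L * (m - 1) \<le> L * (a div L)" by (intro mult_le_mono2) simp
    also have "\<dots> \<le> a" by simp
    finally show ?thesis
      using False assms by (simp add: min_def algebra_simps diff_mult_distrib2)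
  qed
  then show "L * min (a div L) (m - 1) \<le> a" "a < L * min (a div L) (m - 1) + 2 * L" by auto
qed

lemma within_steps_cell:
  assumes "x \<in> torus_verts d n" "y \<in> torus_verts d n" "torus_edges d n \<subseteq> E"
    and "m \<ge> 1" "n < m * L + L" "cell_index d m L x = cell_index d m L y"
  shows "(x, y) \<in> within_steps (edge_rel (torus_verts d n) E) (d * (2 * L))"
proof (rule within_steps_torus[OF assms(1-3)])
  fix s assume s: "s < d"
  have less: "x s < m * L + L" "y s < m * L + L"
    using torus_verts_less[OF assms(1) s] torus_verts_less[OF assms(2) s] assms(5) by simp_all
  have "L > 0" using less(1) by (cases L) auto
  note layer = cell_layer_bounds[OF assms(4) this]
  have same: "min (x s div L) (m - 1) = min (y s div L) (m - 1)"
    using fun_cong[OF assms(6), of s] s by (simp add: cell_index_def)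
  show "\<bar>int (x s) - int (y s)\<bar> \<le> int (2 * L)"
    using layer[OF less(1), unfolded same] layer[OF less(2)] by linarith
qed

section \<open>The Newman--Watts graph\<close>

lemma finite_long_pairs: "finite (long_pairs d \<alpha> \<beta> n)"
proof (rule finite_subset)
  show "long_pairs d \<alpha> \<beta> n \<subseteq> (\<lambda>(u, v). {u, v}) ` (torus_verts d n \<times> torus_verts d n)"
    unfolding long_pairs_def by auto
qed (simp add: finite_torus_verts)

lemma torus_dist_ge_of_long_pair:
  assumes "e \<in> long_pairs d \<alpha> \<beta> n" "x \<in> e" "y \<in> e" "x \<noteq> y"
  shows "\<alpha> * real n \<le> real_of_int (torus_dist d n x y)"
  using assms torus_dist_commute[of d n] by (auto simp: long_pairs_def)

definition long_pairs_at ::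
  "nat \<Rightarrow> real \<Rightarrow> real \<Rightarrow> nat \<Rightarrow> (nat \<Rightarrow> nat) set \<Rightarrow> (nat \<Rightarrow> nat) set set" where
  "long_pairs_at d \<alpha> \<beta> n C = {e \<in> long_pairs d \<alpha> \<beta> n. e \<inter> C \<noteq> {}}"

lemma card_long_pairs_at_le:
  assumes "finite C"
  shows "card (long_pairs_at d \<alpha> \<beta> n C) \<le> card C * n ^ d"
proof -
  have "long_pairs_at d \<alpha> \<beta> n C \<subseteq> (\<lambda>(u, v). {u, v}) ` (C \<times> torus_verts d n)"
    by (auto simp: long_pairs_at_def long_pairs_def image_iff insert_commute)
  then have "card (long_pairs_at d \<alpha> \<beta> n C) \<le> card (C \<times> torus_verts d n)"
    using assms finite_torus_verts by (intro surj_card_le) auto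
  then show ?thesis by (simp add: card_cartesian_product card_torus_verts)
qed

lemma card_long_pairs_at_ball_le:
  assumes "d \<ge> 1" "c \<in> torus_verts d n" "2 * t + 1 \<le> n"
  shows "card (long_pairs_at d \<alpha> \<beta> n (torus_ball d n c t)) \<le> (2 * t + 1) ^ d * n ^ d"
proof -
  have "finite (torus_ball d n c t)" by (simp add: torus_ball_def finite_torus_verts)
  then show ?thesis
    using card_long_pairs_at_le[of "torus_ball d n c t" d \<alpha> \<beta> n] card_torus_ball[OF assms] by simp
qed

lemma card_long_neighbours_ge:
  assumes "d \<ge> 1" "u \<in> torus_verts d n" "2 * a + 1 \<le> n" "2 * b + 1 \<le> n"
    and "\<alpha> * real n < real a + 1" "real b \<le> \<beta> * real n"
  shows "(2 * b + 1) ^ d \<le>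
    card (neighbours (torus_verts d n) (long_pairs d \<alpha> \<beta> n) u) + (2 * a + 1) ^ d"
proof -
  let ?N = "neighbours (torus_verts d n) (long_pairs d \<alpha> \<beta> n) u"
  have "torus_ball d n u b \<subseteq> ?N \<union> torus_ball d n u a"
  proof
    fix v assume v: "v \<in> torus_ball d n u b"
    show "v \<in> ?N \<union> torus_ball d n u a"
    proof (cases "torus_dist d n u v \<le> int a")
      case False
      then have "u \<noteq> v" using torus_dist_self_le[OF assms(1), of n u] by auto
      moreover have "\<alpha> * real n \<le> real_of_int (torus_dist d n u v)"
        using False assms(5) by linarith
      moreover have "real_of_int (torus_dist d n u v) \<le> real b"
        using v unfolding torus_ball_def mem_Collect_eq by linarith
      ultimately have "{u, v} \<in> long_pairs d \<alpha> \<beta> n"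
        unfolding long_pairs_def using assms(2,6) v
        by (intro CollectI exI[of _ u] exI[of _ v]) (auto simp: torus_ball_def)
      then show ?thesis using v by (simp add: torus_ball_def neighbours_def)
    qed (use v in \<open>simp add: torus_ball_def\<close>)
  qed
  then have "card (torus_ball d n u b) \<le> card (?N \<union> torus_ball d n u a)"
    using finite_torus_verts by (intro card_mono) (auto simp: torus_ball_def neighbours_def)
  also have "\<dots> \<le> card ?N + card (torus_ball d n u a)" by (rule card_Un_le)
  finally show ?thesis using card_torus_ball[OF assms(1,2)] assms(3,4) by simp
qed

lemma eventually_card_long_neighbours_ge:
  assumes "d \<ge> 1" "0 < \<alpha>" "\<alpha> < \<beta>" "\<beta> < 1 / 2" and "c < (2 * \<beta>) ^ d - (2 * \<alpha>) ^ d"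
  shows "\<forall>\<^sub>F n in sequentially. \<forall>u \<in> torus_verts d n.
    c * real n ^ d \<le> real (card (neighbours (torus_verts d n) (long_pairs d \<alpha> \<beta> n) u))"
proof -
  define t where "t \<gamma> n = nat \<lfloor>\<gamma> * real n\<rfloor>" for \<gamma> :: real and n :: nat
  have width_tendsto: "(\<lambda>n. (2 * real (t \<gamma> n) + 1) / real n) \<longlonglongrightarrow> 2 * \<gamma>" if "\<gamma> > 0" for \<gamma>
    unfolding t_def using that by real_asymp
  have "(\<lambda>n. ((2 * real (t \<beta> n) + 1) / real n) ^ d - ((2 * real (t \<alpha> n) + 1) / real n) ^ d)
      \<longlonglongrightarrow> (2 * \<beta>) ^ d - (2 * \<alpha>) ^ d"
    using assms(2,3) by (intro tendsto_intros width_tendsto) auto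
  then have density: "\<forall>\<^sub>F n in sequentially.
      c < ((2 * real (t \<beta> n) + 1) / real n) ^ d - ((2 * real (t \<alpha> n) + 1) / real n) ^ d"
    using assms(5) by (rule order_tendstoD)
  have narrow: "\<forall>\<^sub>F n in sequentially. (2 * real (t \<gamma> n) + 1) / real n < 1"
    if "0 < \<gamma>" "\<gamma> < 1 / 2" for \<gamma>
    using order_tendstoD(2)[OF width_tendsto, of \<gamma> 1] that by simp
  have "\<forall>\<^sub>F n in sequentially. (2 * real (t \<alpha> n) + 1) / real n < 1"
    "\<forall>\<^sub>F n in sequentially. (2 * real (t \<beta> n) + 1) / real n < 1"
    using assms by (auto intro: narrow)
  from this density eventually_gt_at_top[of 0]
  show ?thesis
  proof eventually_elim
    case (elim n)
    have n_pos: "0 < real n" using elim(4) by simp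
    have widths: "2 * t \<alpha> n + 1 \<le> n" "2 * t \<beta> n + 1 \<le> n"
      using elim(1,2) n_pos by (simp_all add: field_simps)
    have "c * real n ^ d \<le> (2 * real (t \<beta> n) + 1) ^ d - (2 * real (t \<alpha> n) + 1) ^ d"
      using elim(3) n_pos by (simp add: power_divide field_simps)
    moreover have "(2 * t \<beta> n + 1) ^ d \<le>
        card (neighbours (torus_verts d n) (long_pairs d \<alpha> \<beta> n) u) + (2 * t \<alpha> n + 1) ^ d"
      if "u \<in> torus_verts d n" for u
    proof (rule card_long_neighbours_ge[OF assms(1) that widths])
      show "\<alpha> * real n < real (t \<alpha> n) + 1" "real (t \<beta> n) \<le> \<beta> * real n"
        using assms(2,3) unfolding t_def by (linarith, simp)
    qed
    then have "real ((2 * t \<beta> n + 1) ^ d) \<le>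
        real (card (neighbours (torus_verts d n) (long_pairs d \<alpha> \<beta> n) u) + (2 * t \<alpha> n + 1) ^ d)"
      if "u \<in> torus_verts d n" for u
      using that of_nat_mono by blast
    ultimately show ?case by (fastforce simp: algebra_simps)
  qed
qed

lemma newman_watts_eq:
  "newman_watts d \<alpha> \<beta> \<sigma> \<zeta> n = map_pmf ((\<union>) (torus_edges d n))
     (bernoulli_subset_pmf (long_pairs d \<alpha> \<beta> n) (long_edge_prob d \<sigma> \<zeta> n))"
  by (simp add: newman_watts_def bernoulli_subset_pmf_def map_pmf_comp)

lemma prob_newman_watts:
  "measure_pmf.prob (newman_watts d \<alpha> \<beta> \<sigma> \<zeta> n) {E. Q E} =
   measure_pmf.prob (bernoulli_subset_pmf (long_pairs d \<alpha> \<beta> n) (long_edge_prob d \<sigma> \<zeta> n))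
     {F. Q (torus_edges d n \<union> F)}"
  by (simp add: newman_watts_eq vimage_def)

lemma long_edge_prob_nonneg: "\<sigma> \<ge> 0 \<Longrightarrow> 0 \<le> long_edge_prob d \<sigma> \<zeta> n"
  by (simp add: long_edge_prob_def)

lemma long_edge_prob_mult_card:
  "n > 0 \<Longrightarrow> long_edge_prob d \<sigma> \<zeta> n * real n ^ d = \<sigma> * ln (real n) powr \<zeta>"
  by (simp add: long_edge_prob_def powr_minus powr_realpow field_simps)

lemma eventually_long_edge_prob_le:
  assumes "d \<ge> 1" "\<epsilon> > 0"
  shows "\<forall>\<^sub>F n in sequentially. long_edge_prob d \<sigma> \<zeta> n \<le> \<epsilon>"
proof -
  define D where "D = real d"
  have "D > 0" using assms(1) by (simp add: D_def)
  then have "(\<lambda>n. \<sigma> * real n powr (- D) * ln (real n) powr \<zeta>) \<longlonglongrightarrow> 0"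
    by real_asymp
  then have "\<forall>\<^sub>F n in sequentially. \<sigma> * real n powr (- D) * ln (real n) powr \<zeta> < \<epsilon>"
    using assms(2) by (simp add: order_tendsto_iff)
  then show ?thesis
    unfolding long_edge_prob_def D_def by (rule eventually_mono) auto
qed

section \<open>Lower bounds on the diameter\<close>

lemma long_pairs_at_balls_disjoint:
  assumes "d \<ge> 1" "c \<in> torus_verts d n" "c' \<in> torus_verts d n"
    and apart: "2 * int t < torus_dist d n c c'"
    and close: "real_of_int (torus_dist d n c c' + 2 * int t) < \<alpha> * real n"
  shows "long_pairs_at d \<alpha> \<beta> n (torus_ball d n c t) \<inter>
    long_pairs_at d \<alpha> \<beta> n (torus_ball d n c' t) = {}"
proof (rule ccontr)
  assume "\<not> ?thesis"
  then obtain e x y where e: "e \<in> long_pairs d \<alpha> \<beta> n" "x \<in> e" "y \<in> e"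
    and x: "x \<in> torus_verts d n" "torus_dist d n c x \<le> int t"
    and y: "y \<in> torus_verts d n" "torus_dist d n c' y \<le> int t"
    by (auto simp: long_pairs_at_def torus_ball_def)
  have "torus_dist d n c c' \<le> torus_dist d n c x + torus_dist d n x c'"
    and "torus_dist d n x y \<le> torus_dist d n x c + torus_dist d n c y"
    and "torus_dist d n c y \<le> torus_dist d n c c' + torus_dist d n c' y"
    using assms(1-3) x(1) y(1) by (auto intro: torus_dist_triangle)
  note triangle = this[unfolded torus_dist_commute[of d n x c] torus_dist_commute[of d n x c']]
  have "x \<noteq> y" using triangle(1) x(2) y(2) apart by auto
  then have "\<alpha> * real n \<le> real_of_int (torus_dist d n x y)"
    by (rule torus_dist_ge_of_long_pair[OF e])
  moreover have "torus_dist d n x y \<le> torus_dist d n c c' + 2 * int t"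
    using triangle(2,3) x(2) y(2) by linarith
  ultimately show False using close by linarith
qed

definition axis_point :: "nat \<Rightarrow> nat \<Rightarrow> nat \<Rightarrow> nat" where
  "axis_point d a = restrict (\<lambda>s. if s = 0 then a else 0) {..<d}"

lemma axis_point_in_torus: "a < n \<Longrightarrow> axis_point d a \<in> torus_verts d n"
  by (auto simp: axis_point_def torus_verts_def)

lemma torus_dist_axis_points:
  assumes "d \<ge> 1" "a \<le> b" "2 * (b - a) \<le> n"
  shows "torus_dist d n (axis_point d a) (axis_point d b) = int (b - a)"
proof (rule antisym)
  have "circle_dist n a b = int (b - a)"
    using assms(2,3) by (auto simp: circle_dist_def min_def of_nat_diff)
  then show "torus_dist d n (axis_point d a) (axis_point d b) \<le> int (b - a)"
    "int (b - a) \<le> torus_dist d n (axis_point d a) (axis_point d b)"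
    using assms(1) circle_dist_le_torus_dist[of 0 d n "axis_point d a" "axis_point d b"]
    by (auto simp: torus_dist_le_iff axis_point_def circle_dist_def)
qed

lemma disjoint_family_long_pairs_at_balls:
  assumes "d \<ge> 1" and line_fits: "2 * (m * (2 * t + 1)) \<le> n"
    and close: "real (m * (2 * t + 1)) \<le> \<alpha> * real n"
  shows "disjoint_family_on
    (\<lambda>i. long_pairs_at d \<alpha> \<beta> n (torus_ball d n (axis_point d (i * (2 * t + 1))) t)) {..<m}"
proof -
  let ?w = "2 * t + 1"
  let ?ball = "\<lambda>i. torus_ball d n (axis_point d (i * ?w)) t"
  have disjoint: "long_pairs_at d \<alpha> \<beta> n (?ball i) \<inter> long_pairs_at d \<alpha> \<beta> n (?ball j) = {}"
    if ij: "i < j" "j < m" for i j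
  proof (rule long_pairs_at_balls_disjoint[OF assms(1)])
    have step: "k * ?w + ?w \<le> m * ?w" if "k < m" for k
      using mult_le_mono1[of "Suc k" m ?w] that by simp
    show "axis_point d (i * ?w) \<in> torus_verts d n" "axis_point d (j * ?w) \<in> torus_verts d n"
      using step[of i] step[of j] ij line_fits by (auto intro!: axis_point_in_torus)
    have gap: "?w \<le> (j - i) * ?w" "(j - i) * ?w + ?w \<le> m * ?w"
      using mult_le_mono1[of 1 "j - i" ?w] step[of "j - i"] ij by auto
    have "i * ?w \<le> j * ?w" using ij by (intro mult_le_mono1) simp
    moreover have "2 * (j * ?w - i * ?w) \<le> n"
      using gap line_fits unfolding diff_mult_distrib[symmetric] by linarith
    ultimately have "torus_dist d n (axis_point d (i * ?w)) (axis_point d (j * ?w)) = int ((j - i) * ?w)"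
      unfolding diff_mult_distrib by (rule torus_dist_axis_points[OF assms(1)])
    then show "2 * int t < torus_dist d n (axis_point d (i * ?w)) (axis_point d (j * ?w))"
      "real_of_int (torus_dist d n (axis_point d (i * ?w)) (axis_point d (j * ?w)) + 2 * int t) <
        \<alpha> * real n"
      using gap close by linarith+
  qed
  show ?thesis
    unfolding disjoint_family_on_def
  proof (intro ballI impI)
    fix i j assume "i \<in> {..<m}" "j \<in> {..<m}" "i \<noteq> j"
    then show "long_pairs_at d \<alpha> \<beta> n (?ball i) \<inter> long_pairs_at d \<alpha> \<beta> n (?ball j) = {}"
      using disjoint[of i j] disjoint[of j i] by (cases "i < j") (auto simp: Int_commute)
  qed
qed

lemma prob_diam_le_le:
  assumes "d \<ge> 1" "\<alpha> \<le> 1 / 2" "0 \<le> p" "p \<le> 1 / 2"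
    and "real (m * (2 * t + 1)) \<le> \<alpha> * real n"
  shows "measure_pmf.prob (bernoulli_subset_pmf (long_pairs d \<alpha> \<beta> n) p)
      {F. graph_diam (torus_verts d n) (torus_edges d n \<union> F) \<le> t} \<le>
    exp (- real m * exp (- 2 * p * real ((2 * t + 1) ^ d * n ^ d)))"
proof -
  define P where "P = long_pairs d \<alpha> \<beta> n"
  define A where
    "A i = long_pairs_at d \<alpha> \<beta> n (torus_ball d n (axis_point d (i * (2 * t + 1))) t)" for i
  have "\<alpha> * real n \<le> 1 / 2 * real n" using assms(2) by (intro mult_right_mono) auto
  then have line_fits: "2 * (m * (2 * t + 1)) \<le> n" using assms(5) by linarith
  have center: "axis_point d (i * (2 * t + 1)) \<in> torus_verts d n" "2 * Suc t \<le> n" if "i < m" for i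
    using mult_le_mono1[of "Suc i" m "2 * t + 1"] that line_fits by (auto intro!: axis_point_in_torus)
  have "measure_pmf.prob (bernoulli_subset_pmf P p)
      {F. graph_diam (torus_verts d n) (torus_edges d n \<union> F) \<le> t} \<le>
    measure_pmf.prob (bernoulli_subset_pmf P p) {F. \<forall>i\<in>{..<m}. F \<inter> A i \<noteq> {}}"
  proof (intro measure_pmf.finite_measure_mono_AE AE_pmfI impI CollectI ballI notI)
    fix F i assume F: "F \<in> set_pmf (bernoulli_subset_pmf P p)"
      "F \<in> {F. graph_diam (torus_verts d n) (torus_edges d n \<union> F) \<le> t}"
      and i: "i \<in> {..<m}" "F \<inter> A i = {}"
    have "F \<subseteq> P" using F(1) by (auto simp: bernoulli_subset_pmf_def)
    then have "t < graph_diam (torus_verts d n) (torus_edges d n \<union> F)"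
      using i center[of i]
      by (intro less_graph_diam_of_isolated_ball[OF assms(1)])
        (auto simp: A_def P_def long_pairs_at_def)
    then show False using F(2) by simp
  qed simp
  also have "\<dots> \<le> exp (- real (card {..<m}) * exp (- 2 * p * real ((2 * t + 1) ^ d * n ^ d)))"
  proof (rule prob_bernoulli_subset_meets_all_le)
    show "finite P" by (simp add: P_def finite_long_pairs)
    show "disjoint_family_on A {..<m}"
      unfolding A_def using assms(1) line_fits assms(5)
      by (rule disjoint_family_long_pairs_at_balls)
    show "A i \<subseteq> P" for i by (auto simp: A_def P_def long_pairs_at_def)
    show "card (A i) \<le> (2 * t + 1) ^ d * n ^ d" if "i \<in> {..<m}" for i
      unfolding A_def using center[of i] that by (intro card_long_pairs_at_ball_le assms(1)) auto
  qed (use assms in auto)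
  finally show ?thesis by (simp add: P_def)
qed

lemma eventually_ln_powr_le:
  fixes a b \<mu> \<nu> :: real
  assumes "\<mu> < \<nu> \<or> \<mu> = \<nu> \<and> a \<le> b" "b > 0"
  shows "\<forall>\<^sub>F n in sequentially. a * ln (real n) powr \<mu> \<le> b * ln (real n) powr \<nu>"
proof (cases "\<mu> < \<nu>")
  case True
  define \<delta> where "\<delta> = \<nu> - \<mu>"
  have "\<delta> > 0" using True by (simp add: \<delta>_def)
  then have "\<forall>\<^sub>F n in sequentially. a \<le> b * ln (real n) powr \<delta>" using assms(2) by real_asymp
  then show ?thesis
  proof eventually_elim
    case (elim n)
    then have "a * ln (real n) powr \<mu> \<le> b * ln (real n) powr \<delta> * ln (real n) powr \<mu>"
      by (intro mult_right_mono) auto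
    then show ?case by (simp add: \<delta>_def mult.assoc powr_add[symmetric])
  qed
next
  case False
  then show ?thesis using assms(1) by (auto intro!: always_eventually mult_right_mono)
qed

lemma double_floor_plus_one_le:
  assumes "1 \<le> (x :: real)"
  shows "real (2 * nat \<lfloor>x\<rfloor> + 1) \<le> 3 * x"
  using assms by simp linarith

lemma expected_long_edges_at_ball_le:
  assumes "n > 0" "ln (real n) \<ge> 1" "\<sigma> \<ge> 0" "\<nu> \<ge> 0"
  shows "long_edge_prob d \<sigma> \<zeta> n * real ((2 * nat \<lfloor>ln (real n) powr \<nu>\<rfloor> + 1) ^ d * n ^ d) \<le>
    \<sigma> * 3 ^ d * ln (real n) powr (\<nu> * real d + \<zeta>)"
proof -
  define t where "t = nat \<lfloor>ln (real n) powr \<nu>\<rfloor>"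
  have "1 \<le> ln (real n) powr \<nu>" using assms(2,4) by (rule ge_one_powr_ge_zero)
  then have t_le: "real (2 * t + 1) \<le> 3 * ln (real n) powr \<nu>"
    unfolding t_def by (rule double_floor_plus_one_le)
  have "long_edge_prob d \<sigma> \<zeta> n * real ((2 * t + 1) ^ d * n ^ d) =
      long_edge_prob d \<sigma> \<zeta> n * real n ^ d * real (2 * t + 1) ^ d" by simp
  also have "\<dots> = \<sigma> * ln (real n) powr \<zeta> * real (2 * t + 1) ^ d"
    using long_edge_prob_mult_card[OF assms(1)] by (simp only:)
  also have "\<dots> \<le> \<sigma> * ln (real n) powr \<zeta> * (3 * ln (real n) powr \<nu>) ^ d"
    using t_le assms(3) by (intro mult_left_mono power_mono) auto
  also have "\<dots> = \<sigma> * 3 ^ d * ln (real n) powr (\<nu> * real d + \<zeta>)"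
    using assms(2) by (simp add: powr_add power_mult_distrib powr_powr[symmetric] powr_realpow)
  finally show ?thesis unfolding t_def .
qed

lemma prob_diam_less_ln_powr_le:
  assumes "d \<ge> 1" "n > 0" "ln (real n) \<ge> 1" "\<alpha> \<le> 1 / 2" "\<sigma> \<ge> 0" "\<nu> \<ge> 0"
    and sparse: "long_edge_prob d \<sigma> \<zeta> n \<le> 1 / 2"
      "8 * (\<sigma> * 3 ^ d) * ln (real n) powr (\<nu> * real d + \<zeta>) \<le> ln (real n)"
    and room: "sqrt (real n) * (3 * ln (real n) powr \<nu>) \<le> \<alpha> * real n"
  shows "measure_pmf.prob (newman_watts d \<alpha> \<beta> \<sigma> \<zeta> n)
      {E. real (graph_diam (torus_verts d n) E) < ln (real n) powr \<nu>} \<le>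
    exp (- ((sqrt (real n) - 1) * real n powr (- 1 / 4)))"
proof -
  define t m where "t = nat \<lfloor>ln (real n) powr \<nu>\<rfloor>" and "m = nat \<lfloor>sqrt (real n)\<rfloor>"
  define p where "p = long_edge_prob d \<sigma> \<zeta> n"
  have "1 \<le> ln (real n) powr \<nu>" using assms(3,6) by (rule ge_one_powr_ge_zero)
  then have t_le: "real (2 * t + 1) \<le> 3 * ln (real n) powr \<nu>"
    unfolding t_def by (rule double_floor_plus_one_le)
  have m_bounds: "sqrt (real n) - 1 \<le> real m" "real m \<le> sqrt (real n)"
    unfolding m_def by (linarith, simp)
  have "real (m * (2 * t + 1)) \<le> sqrt (real n) * (3 * ln (real n) powr \<nu>)"
    unfolding of_nat_mult using m_bounds(2) t_le by (intro mult_mono) auto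
  also note room
  finally have fits: "real (m * (2 * t + 1)) \<le> \<alpha> * real n" .
  have "2 * (p * real ((2 * t + 1) ^ d * n ^ d)) \<le> ln (real n) / 4"
    using expected_long_edges_at_ball_le[OF assms(2,3,5,6), of d \<zeta>] sparse(2)
    by (simp add: p_def t_def)
  then have "exp (- (ln (real n) / 4)) \<le> exp (- 2 * p * real ((2 * t + 1) ^ d * n ^ d))" by simp
  then have isolated: "real n powr (- 1 / 4) \<le> exp (- 2 * p * real ((2 * t + 1) ^ d * n ^ d))"
    using assms(2) by (simp add: powr_def)
  have "measure_pmf.prob (newman_watts d \<alpha> \<beta> \<sigma> \<zeta> n)
      {E. real (graph_diam (torus_verts d n) E) < ln (real n) powr \<nu>} \<le>
    measure_pmf.prob (newman_watts d \<alpha> \<beta> \<sigma> \<zeta> n) {E. graph_diam (torus_verts d n) E \<le> t}"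
    by (intro measure_pmf.finite_measure_mono) (auto simp: t_def le_nat_floor)
  also have "\<dots> \<le> exp (- real m * exp (- 2 * p * real ((2 * t + 1) ^ d * n ^ d)))"
    unfolding prob_newman_watts p_def
    using assms(1,4,5) sparse(1) fits by (intro prob_diam_le_le long_edge_prob_nonneg)
  also have "\<dots> \<le> exp (- ((sqrt (real n) - 1) * real n powr (- 1 / 4)))"
    using mult_mono[OF m_bounds(1) isolated] by simp
  finally show ?thesis .
qed

lemma whp_diam_ge:
  assumes "d \<ge> 1" "0 < \<alpha>" "\<alpha> \<le> 1 / 2" "\<sigma> \<ge> 0" "\<nu> \<ge> 0"
    and exponent: "\<nu> * real d + \<zeta> < 1 \<or> \<nu> * real d + \<zeta> = 1 \<and> \<sigma> \<le> 1 / (8 * 3 ^ d)"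
  shows "whp (newman_watts d \<alpha> \<beta> \<sigma> \<zeta>)
    (\<lambda>n E. ln (real n) powr \<nu> \<le> real (graph_diam (torus_verts d n) E))"
proof (rule whpI)
  have "8 * (\<sigma> * 3 ^ d) \<le> 1" if "\<sigma> \<le> 1 / (8 * 3 ^ d)"
    using mult_right_mono[OF that, of "8 * 3 ^ d"] by simp
  then have "\<forall>\<^sub>F n in sequentially.
      8 * (\<sigma> * 3 ^ d) * ln (real n) powr (\<nu> * real d + \<zeta>) \<le> 1 * ln (real n) powr 1"
    using exponent by (intro eventually_ln_powr_le) auto
  moreover have "\<forall>\<^sub>F n in sequentially. ln (real n) \<ge> 1" by real_asymp
  moreover have "\<forall>\<^sub>F n in sequentially. sqrt (real n) * (3 * ln (real n) powr \<nu>) \<le> \<alpha> * real n"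
    using assms(2) by real_asymp
  moreover have "\<forall>\<^sub>F n in sequentially. long_edge_prob d \<sigma> \<zeta> n \<le> 1 / 2"
    using assms(1) by (intro eventually_long_edge_prob_le) auto
  ultimately show "\<forall>\<^sub>F n in sequentially. measure_pmf.prob (newman_watts d \<alpha> \<beta> \<sigma> \<zeta> n)
      {E. \<not> ln (real n) powr \<nu> \<le> real (graph_diam (torus_verts d n) E)} \<le>
    exp (- ((sqrt (real n) - 1) * real n powr (- 1 / 4)))"
    using eventually_gt_at_top[of 0]
  proof eventually_elim
    case (elim n)
    show ?case
      unfolding not_le using assms(1,3-5) elim by (intro prob_diam_less_ln_powr_le) auto
  qed
  show "(\<lambda>n. exp (- ((sqrt (real n) - 1) * real n powr (- 1 / 4)))) \<longlonglongrightarrow> 0" by real_asymp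
qed

section \<open>Upper bounds on the diameter\<close>

lemma dense_coarse_graining_cells:
  assumes "m \<ge> 1" "L \<ge> 1" "m * L \<le> n" and "0 < \<eta>" "\<eta> \<le> 1"
    and degree: "\<And>u. u \<in> torus_verts d n \<Longrightarrow> (1 / 2 + 3 * \<eta>) * real n ^ d \<le>
      real (card (neighbours (torus_verts d n) (long_pairs d \<alpha> \<beta> n) u))"
    and coverage: "(1 - \<eta>) * real n ^ d \<le> real (m * L) ^ d"
  shows "dense_coarse_graining (torus_verts d n) (long_pairs d \<alpha> \<beta> n) (cell_index d m L) (L ^ d) \<eta>"
proof
  show "L ^ d \<le> card (torus_verts d n \<inter> cell_index d m L -` {j})"
    if "j \<in> cell_index d m L ` torus_verts d n" for j
    using that card_cell_ge[OF assms(3)] unfolding cell_index_image[OF assms(1-3)] by simp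
  show "(1 - \<eta>) * real (card (torus_verts d n)) \<le>
      real (card (cell_index d m L ` torus_verts d n) * L ^ d)"
    using coverage unfolding cell_index_image[OF assms(1-3)] card_torus_verts
    by (simp add: power_mult_distrib)
qed (use assms finite_torus_verts finite_long_pairs card_torus_verts in auto)

lemma graph_diam_le_of_expanding_cells:
  assumes "m \<ge> 1" "L \<ge> 1" "m * L \<le> n" "n < m * L + L" "0 < \<eta>"
    and "expanding (torus_verts d m) \<eta>
      (quotient_rel (cell_index d m L) (edge_rel (torus_verts d n) F))"
    and "real m ^ d \<le> (1 + \<eta>) ^ r"
  shows "graph_diam (torus_verts d n) (torus_edges d n \<union> F) \<le>
    2 * (r * (d * (2 * L) + 1) + d * (2 * L))"
proof (rule graph_diam_le_of_expanding[OF finite_torus_verts _ assms(5)])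
  note image = cell_index_image[OF assms(1-3), of d]
  show "expanding (cell_index d m L ` torus_verts d n) \<eta>
      (quotient_rel (cell_index d m L) (edge_rel (torus_verts d n) F))"
    using assms(6) unfolding image .
  show "real (card (cell_index d m L ` torus_verts d n)) \<le> (1 + \<eta>) ^ r"
    using assms(7) unfolding image card_torus_verts by simp
  have "n > 0" using assms(1-3) by (cases n) auto
  then show "torus_verts d n \<noteq> {}" using card_torus_verts[of d n] by auto
  show "(x, y) \<in> within_steps (edge_rel (torus_verts d n) (torus_edges d n \<union> F)) (d * (2 * L))"
    if "x \<in> torus_verts d n" "y \<in> torus_verts d n" "cell_index d m L x = cell_index d m L y" for x y
    using that assms(1,4) by (intro within_steps_cell) auto
qed simp

lemma prob_diam_gt_le:
  assumes cells: "m \<ge> 1" "L \<ge> 1" "m * L \<le> n" "n < m * L + L"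
    and \<eta>_bounds: "0 < \<eta>" "\<eta> \<le> 1" and p_bounds: "0 \<le> p" "p \<le> 1"
    and degree: "\<And>u. u \<in> torus_verts d n \<Longrightarrow> (1 / 2 + 3 * \<eta>) * real n ^ d \<le>
      real (card (neighbours (torus_verts d n) (long_pairs d \<alpha> \<beta> n) u))"
    and coverage: "(1 - \<eta>) * real n ^ d \<le> real (m * L) ^ d"
    and radius: "real m ^ d \<le> (1 + \<eta>) ^ r"
  shows "measure_pmf.prob (bernoulli_subset_pmf (long_pairs d \<alpha> \<beta> n) p)
      {F. 2 * (r * (d * (2 * L) + 1) + d * (2 * L)) <
        graph_diam (torus_verts d n) (torus_edges d n \<union> F)} \<le>
    real n ^ (4 * d) * exp (- p * real L ^ d * \<eta> * real n ^ d)"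
proof -
  interpret dense_coarse_graining "torus_verts d n" "long_pairs d \<alpha> \<beta> n" "cell_index d m L" "L ^ d" \<eta>
    by (rule dense_coarse_graining_cells[OF cells(1-3) \<eta>_bounds degree coverage])
  note image = cell_index_image[OF cells(1-3), of d]
  have m_le_n: "m \<le> n" using cells(3) mult_le_mono2[OF cells(2), of m] by linarith
  have "torus_verts d n \<noteq> {}"
    using m_le_n cells(1) card_torus_verts[of d n] by auto
  have "measure_pmf.prob (bernoulli_subset_pmf (long_pairs d \<alpha> \<beta> n) p)
      {F. 2 * (r * (d * (2 * L) + 1) + d * (2 * L)) <
        graph_diam (torus_verts d n) (torus_edges d n \<union> F)} \<le>
    measure_pmf.prob (bernoulli_subset_pmf (long_pairs d \<alpha> \<beta> n) p)
      {F. \<not> expanding (torus_verts d m) \<eta>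
        (quotient_rel (cell_index d m L) (edge_rel (torus_verts d n) F))}"
    using leD[OF graph_diam_le_of_expanding_cells[OF cells \<eta>_bounds(1) _ radius]]
    by (intro measure_pmf.finite_measure_mono Collect_mono impI notI) (blast, simp)
  also have "\<dots> \<le> real (card (torus_verts d m)) ^ 4 *
      exp (- p * real (L ^ d) * \<eta> * real (card (torus_verts d n)))"
    using prob_not_expanding_le[OF p_bounds \<open>torus_verts d n \<noteq> {}\<close>] unfolding image .
  also have "\<dots> = real m ^ (4 * d) * exp (- p * real L ^ d * \<eta> * real n ^ d)"
    by (simp add: card_torus_verts power_mult[symmetric] mult.commute)
  also have "\<dots> \<le> real n ^ (4 * d) * exp (- p * real L ^ d * \<eta> * real n ^ d)"
    using m_le_n by (intro mult_right_mono power_mono) auto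
  finally show ?thesis .
qed

lemma eventually_cells_cover:
  fixes L :: "nat \<Rightarrow> nat" and \<eta> :: real
  assumes "(\<lambda>n. real (L n) / real n) \<longlonglongrightarrow> 0" "0 < \<eta>" "\<And>n. L n \<ge> 1"
  shows "\<forall>\<^sub>F n in sequentially. (1 - \<eta>) * real n ^ d \<le> real (n div L n * L n) ^ d"
proof -
  have "(\<lambda>n. (1 - real (L n) / real n) ^ d) \<longlonglongrightarrow> (1 - 0) ^ d"
    by (intro tendsto_intros assms(1))
  then have "\<forall>\<^sub>F n in sequentially. 1 - \<eta> < (1 - real (L n) / real n) ^ d"
    by (rule order_tendstoD) (use assms in simp)
  moreover have "\<forall>\<^sub>F n in sequentially. real (L n) / real n < 1"
    using assms(1) by (rule order_tendstoD) simp
  ultimately show ?thesis using eventually_gt_at_top[of 0]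
  proof eventually_elim
    case (elim n)
    have "(1 - \<eta>) * real n ^ d \<le> (1 - real (L n) / real n) ^ d * real n ^ d"
      using elim(1) by (intro mult_right_mono) auto
    also have "\<dots> = (real n - real (L n)) ^ d"
      using elim(3) by (simp add: power_mult_distrib[symmetric] field_simps)
    also have "\<dots> \<le> real (n div L n * L n) ^ d"
    proof (rule power_mono)
      have "n div L n * L n + n mod L n = n" by (rule div_mult_mod_eq)
      moreover have "n mod L n < L n" using assms(3)[of n] by (intro mod_less_divisor) simp
      ultimately show "real n - real (L n) \<le> real (n div L n * L n)" by linarith
      show "0 \<le> real n - real (L n)" using elim(2,3) by (simp add: field_simps)
    qed
    finally show ?case .
  qed
qed

lemma power_le_power_ceiling_ln:
  assumes "m \<le> n" "n > 0" "\<eta> > 0"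
  shows "real m ^ d \<le> (1 + \<eta>) ^ nat \<lceil>real d * ln (real n) / ln (1 + \<eta>)\<rceil>"
proof -
  let ?r = "nat \<lceil>real d * ln (real n) / ln (1 + \<eta>)\<rceil>"
  have "real m ^ d \<le> real n ^ d" using assms(1) by (intro power_mono) auto
  also have "\<dots> = exp (real d * ln (real n))" using assms(2) by (simp add: exp_of_nat_mult)
  also have "\<dots> \<le> exp (real ?r * ln (1 + \<eta>))"
  proof -
    have "real d * ln (real n) / ln (1 + \<eta>) \<le> real ?r" by linarith
    then show ?thesis using assms(3) by (simp add: field_simps)
  qed
  also have "\<dots> = (1 + \<eta>) ^ ?r" using assms(3) by (simp add: exp_of_nat_mult)
  finally show ?thesis .
qed

definition diam_const :: "nat \<Rightarrow> real \<Rightarrow> real" where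
  "diam_const d \<eta> = 6 * real d * (real d / ln (1 + \<eta>) + 2)"

lemma diam_const_pos: "d \<ge> 1 \<Longrightarrow> \<eta> > 0 \<Longrightarrow> diam_const d \<eta> > 0"
  unfolding diam_const_def by (intro mult_pos_pos add_nonneg_pos) auto

lemma expanding_diam_bound_le_ln:
  fixes \<eta> \<Lambda> :: real
  assumes "d \<ge> 1" "L \<ge> 1" "\<eta> > 0" "\<Lambda> \<ge> 1" "r = nat \<lceil>real d * \<Lambda> / ln (1 + \<eta>)\<rceil>"
  shows "real (2 * (r * (d * (2 * L) + 1) + d * (2 * L))) \<le>
    diam_const d \<eta> * real L * \<Lambda>"
proof -
  define D where "D = d * L"
  have "1 \<le> D" using mult_le_mono[OF assms(1,2)] by (simp add: D_def)
  then have "r \<le> D * r" using mult_le_mono1[of 1 D r] by simp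
  have "2 * (r * (2 * D + 1) + 2 * D) = 4 * (D * r) + 2 * r + 4 * D" by (simp add: algebra_simps)
  also have "\<dots> \<le> 6 * (D * r) + 6 * D" using \<open>r \<le> D * r\<close> by linarith
  also have "\<dots> = 6 * D * (r + 1)" by (simp add: algebra_simps)
  finally have "real (2 * (r * (2 * D + 1) + 2 * D)) \<le> real (6 * D * (r + 1))"
    by (rule of_nat_mono)
  also have "\<dots> = 6 * real D * (real r + 1)" by (simp add: algebra_simps)
  also have "\<dots> \<le> 6 * real D * ((real d / ln (1 + \<eta>) + 2) * \<Lambda>)"
  proof (rule mult_left_mono)
    have "0 \<le> real d * \<Lambda> / ln (1 + \<eta>)" using assms(3,4) by simp
    then have "real r \<le> real d * \<Lambda> / ln (1 + \<eta>) + 1" unfolding assms(5) by linarith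
    then show "real r + 1 \<le> (real d / ln (1 + \<eta>) + 2) * \<Lambda>" using assms(4)
      by (simp add: algebra_simps)
  qed simp
  finally show ?thesis by (simp add: D_def diam_const_def mult_ac)
qed

lemma prob_diam_gt_ln_le:
  assumes "d \<ge> 1" "n > 0" "ln (real n) \<ge> 1" "1 \<le> L" "L \<le> n"
    and \<eta>_bounds: "0 < \<eta>" "\<eta> \<le> 1" and p_bounds: "0 \<le> p" "p \<le> 1"
    and density: "(4 * real d + 1) * ln (real n) \<le> \<eta> * (p * real n ^ d * real L ^ d)"
    and degree: "\<And>u. u \<in> torus_verts d n \<Longrightarrow> (1 / 2 + 3 * \<eta>) * real n ^ d \<le>
      real (card (neighbours (torus_verts d n) (long_pairs d \<alpha> \<beta> n) u))"
    and coverage: "(1 - \<eta>) * real n ^ d \<le> real (n div L * L) ^ d"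
  shows "measure_pmf.prob (bernoulli_subset_pmf (long_pairs d \<alpha> \<beta> n) p)
      {F. \<not> real (graph_diam (torus_verts d n) (torus_edges d n \<union> F)) \<le>
        diam_const d \<eta> * real L * ln (real n)} \<le> 1 / real n"
proof -
  define m r where "m = n div L" and "r = nat \<lceil>real d * ln (real n) / ln (1 + \<eta>)\<rceil>"
  have cells: "m \<ge> 1" "L \<ge> 1" "m * L \<le> n" "n < m * L + L"
    using assms(4,5) div_greater_zero_iff[of n L] dividend_less_div_times[of L n]
    by (auto simp: m_def Suc_le_eq)
  let ?K = "2 * (r * (d * (2 * L) + 1) + d * (2 * L))"
  have "measure_pmf.prob (bernoulli_subset_pmf (long_pairs d \<alpha> \<beta> n) p)
      {F. \<not> real (graph_diam (torus_verts d n) (torus_edges d n \<union> F)) \<le>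
        diam_const d \<eta> * real L * ln (real n)} \<le>
    measure_pmf.prob (bernoulli_subset_pmf (long_pairs d \<alpha> \<beta> n) p)
      {F. ?K < graph_diam (torus_verts d n) (torus_edges d n \<union> F)}"
  proof (intro measure_pmf.finite_measure_mono Collect_mono impI)
    fix F assume "\<not> real (graph_diam (torus_verts d n) (torus_edges d n \<union> F)) \<le>
        diam_const d \<eta> * real L * ln (real n)"
    then have "real ?K < real (graph_diam (torus_verts d n) (torus_edges d n \<union> F))"
      using expanding_diam_bound_le_ln[OF assms(1,4) \<eta>_bounds(1) assms(3) r_def] by linarith
    then show "?K < graph_diam (torus_verts d n) (torus_edges d n \<union> F)"
      by (simp only: of_nat_less_iff)
  qed simp
  also have "\<dots> \<le> real n ^ (4 * d) * exp (- p * real L ^ d * \<eta> * real n ^ d)"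
    unfolding r_def m_def
    by (intro prob_diam_gt_le[OF cells[unfolded m_def] \<eta>_bounds p_bounds degree coverage]
        power_le_power_ceiling_ln assms(2) \<eta>_bounds(1) div_le_dividend)
  also have "\<dots> \<le> real n ^ (4 * d) * exp (- (real (4 * d + 1) * ln (real n)))"
    using density by (intro mult_left_mono) (auto simp: ac_simps)
  also have "exp (- (real (4 * d + 1) * ln (real n))) = 1 / real n ^ (4 * d + 1)"
    using assms(2) unfolding exp_minus exp_of_nat_mult by (simp add: divide_inverse)
  also have "real n ^ (4 * d) * (1 / real n ^ (4 * d + 1)) = 1 / real n"
    using assms(2) by simp
  finally show ?thesis .
qed

lemma whp_diam_le_of_side:
  fixes L :: "nat \<Rightarrow> nat"
  assumes "d \<ge> 1" "0 < \<alpha>" "\<alpha> < \<beta>" "\<beta> < 1 / 2" "\<sigma> > 0"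
    and expansion: "0 < \<eta>" "1 / 2 + 3 * \<eta> < (2 * \<beta>) ^ d - (2 * \<alpha>) ^ d"
    and side: "\<And>n. L n \<ge> 1" "(\<lambda>n. real (L n) / real n) \<longlonglongrightarrow> 0"
    and density: "\<forall>\<^sub>F n in sequentially.
      (4 * real d + 1) * ln (real n) \<le> \<eta> * (\<sigma> * ln (real n) powr \<zeta> * real (L n) ^ d)"
  shows "whp (newman_watts d \<alpha> \<beta> \<sigma> \<zeta>) (\<lambda>n E. real (graph_diam (torus_verts d n) E) \<le>
    diam_const d \<eta> * real (L n) * ln (real n))"
proof (rule whpI)
  have "(2 * \<beta>) ^ d \<le> 1" using assms(2-4) by (intro power_le_one) auto
  moreover have "0 \<le> (2 * \<alpha>) ^ d" using assms(2) by simp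
  ultimately have \<eta>_le_1: "\<eta> \<le> 1" using expansion(2) by linarith
  have "\<forall>\<^sub>F n in sequentially. ln (real n) \<ge> 1" by real_asymp
  moreover have "\<forall>\<^sub>F n in sequentially. long_edge_prob d \<sigma> \<zeta> n \<le> 1"
    using assms(1) by (intro eventually_long_edge_prob_le) auto
  moreover have "\<forall>\<^sub>F n in sequentially. real (L n) / real n < 1"
    using side(2) by (rule order_tendstoD) simp
  ultimately show "\<forall>\<^sub>F n in sequentially. measure_pmf.prob (newman_watts d \<alpha> \<beta> \<sigma> \<zeta> n)
      {E. \<not> real (graph_diam (torus_verts d n) E) \<le>
        diam_const d \<eta> * real (L n) * ln (real n)} \<le> 1 / real n"
    using density eventually_card_long_neighbours_ge[OF assms(1-4) expansion(2)]
      eventually_cells_cover[OF side(2) expansion(1) side(1), of d] eventually_gt_at_top[of 0]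
  proof eventually_elim
    case (elim n)
    show ?case
      unfolding prob_newman_watts
      using assms(1) elim side(1) expansion \<eta>_le_1 long_edge_prob_nonneg[of \<sigma>] assms(5)
      by (intro prob_diam_gt_ln_le) (simp_all add: long_edge_prob_mult_card)
  qed
  show "(\<lambda>n. 1 / real n) \<longlonglongrightarrow> 0" by real_asymp
qed

definition cell_side :: "real \<Rightarrow> nat \<Rightarrow> nat" where
  "cell_side \<kappa> n = Suc (nat \<lfloor>ln (real n) powr \<kappa>\<rfloor>)"

lemma cell_side_ge: "ln (real n) powr \<kappa> \<le> real (cell_side \<kappa> n)"
  unfolding cell_side_def by linarith

lemma eventually_cell_side_le:
  assumes "\<kappa> \<ge> 0"
  shows "\<forall>\<^sub>F n in sequentially. real (cell_side \<kappa> n) \<le> 2 * ln (real n) powr \<kappa>"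
proof -
  have "\<forall>\<^sub>F n in sequentially. ln (real n) \<ge> 1" by real_asymp
  then show ?thesis
  proof eventually_elim
    case (elim n)
    then have "1 \<le> ln (real n) powr \<kappa>" using assms by (simp add: ge_one_powr_ge_zero)
    then show ?case unfolding cell_side_def by linarith
  qed
qed

lemma cell_side_over_n_tendsto_0:
  assumes "\<kappa> \<ge> 0"
  shows "(\<lambda>n. real (cell_side \<kappa> n) / real n) \<longlonglongrightarrow> 0"
proof (rule tendsto_sandwich[of "\<lambda>_. 0"])
  show "\<forall>\<^sub>F n in sequentially. real (cell_side \<kappa> n) / real n \<le> 2 * ln (real n) powr \<kappa> / real n"
    using eventually_cell_side_le[OF assms] by eventually_elim (auto intro!: divide_right_mono)
  show "(\<lambda>n. 2 * ln (real n) powr \<kappa> / real n) \<longlonglongrightarrow> 0" by real_asymp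
qed auto

lemma eventually_cell_density_ge:
  fixes a \<sigma> \<kappa> \<zeta> :: real
  assumes "1 < \<kappa> * real d + \<zeta> \<or> 1 = \<kappa> * real d + \<zeta> \<and> a \<le> \<sigma>" "\<sigma> > 0"
  shows "\<forall>\<^sub>F n in sequentially.
    a * ln (real n) \<le> \<sigma> * ln (real n) powr \<zeta> * real (cell_side \<kappa> n) ^ d"
proof -
  have "\<forall>\<^sub>F n in sequentially. a * ln (real n) powr 1 \<le> \<sigma> * ln (real n) powr (\<kappa> * real d + \<zeta>)"
    using assms by (rule eventually_ln_powr_le)
  moreover have "\<forall>\<^sub>F n in sequentially. ln (real n) \<ge> 1" by real_asymp
  ultimately show ?thesis
  proof eventually_elim
    case (elim n)
    have "a * ln (real n) \<le> \<sigma> * ln (real n) powr \<zeta> * (ln (real n) powr \<kappa>) ^ d"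
      using elim by (simp add: powr_add powr_powr[symmetric] powr_realpow mult_ac)
    also have "\<dots> \<le> \<sigma> * ln (real n) powr \<zeta> * real (cell_side \<kappa> n) ^ d"
      using cell_side_ge assms(2) by (intro mult_left_mono power_mono) auto
    finally show ?case .
  qed
qed

lemma whp_diam_le_ln_powr:
  assumes "d \<ge> 1" "0 < \<alpha>" "\<alpha> < \<beta>" "\<beta> < 1 / 2" "\<sigma> > 0"
    and expansion: "0 < \<eta>" "1 / 2 + 3 * \<eta> < (2 * \<beta>) ^ d - (2 * \<alpha>) ^ d" and "\<kappa> \<ge> 0"
    and exponent: "1 < \<kappa> * real d + \<zeta> \<or> 1 = \<kappa> * real d + \<zeta> \<and> (4 * real d + 1) / \<eta> \<le> \<sigma>"
  shows "whp (newman_watts d \<alpha> \<beta> \<sigma> \<zeta>) (\<lambda>n E. real (graph_diam (torus_verts d n) E) \<le>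
    2 * diam_const d \<eta> * ln (real n) powr (\<kappa> + 1))"
proof -
  let ?C = "diam_const d \<eta>"
  have C_pos: "?C > 0" using assms(1) expansion(1) by (rule diam_const_pos)
  have "\<forall>\<^sub>F n in sequentially.
      (4 * real d + 1) * ln (real n) \<le> \<eta> * (\<sigma> * ln (real n) powr \<zeta> * real (cell_side \<kappa> n) ^ d)"
    using eventually_cell_density_ge[OF exponent assms(5)]
    by eventually_elim (use expansion(1) in \<open>simp add: field_simps\<close>)
  then have "whp (newman_watts d \<alpha> \<beta> \<sigma> \<zeta>)
      (\<lambda>n E. real (graph_diam (torus_verts d n) E) \<le> ?C * real (cell_side \<kappa> n) * ln (real n))"
    using assms(1-5) expansion cell_side_over_n_tendsto_0[OF assms(8)]
    by (intro whp_diam_le_of_side) (auto simp: cell_side_def)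
  then show ?thesis
  proof (rule whp_mono)
    have "\<forall>\<^sub>F n in sequentially. ln (real n) \<ge> 1" by real_asymp
    with eventually_cell_side_le[OF assms(8)] show "\<forall>\<^sub>F n in sequentially. \<forall>E.
        real (graph_diam (torus_verts d n) E) \<le> ?C * real (cell_side \<kappa> n) * ln (real n) \<longrightarrow>
        real (graph_diam (torus_verts d n) E) \<le> 2 * ?C * ln (real n) powr (\<kappa> + 1)"
    proof eventually_elim
      case (elim n)
      have "?C * real (cell_side \<kappa> n) * ln (real n) \<le> ?C * (2 * ln (real n) powr \<kappa>) * ln (real n)"
        using elim C_pos by (intro mult_right_mono mult_left_mono) auto
      also have "\<dots> = 2 * diam_const d \<eta> * ln (real n) powr (\<kappa> + 1)"
        using elim(2) by (simp add: powr_add)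
      finally show ?case by auto
    qed
  qed
qed

lemma whp_diam_le_ln_power:
  assumes "d \<ge> 1" "0 < \<alpha>" "\<alpha> < \<beta>" "\<beta> < 1 / 2" "0 < \<eta>" "1 / 2 + 3 * \<eta> < (2 * \<beta>) ^ d - (2 * \<alpha>) ^ d"
    and "\<sigma> > 0" "\<kappa> \<ge> 0" "\<kappa> + 1 \<le> real k"
    and "1 < \<kappa> * real d + \<zeta> \<or> 1 = \<kappa> * real d + \<zeta> \<and> (4 * real d + 1) / \<eta> \<le> \<sigma>"
  shows "\<exists>C>0. whp (newman_watts d \<alpha> \<beta> \<sigma> \<zeta>)
    (\<lambda>n E. real (graph_diam (torus_verts d n) E) \<le> C * ln (real n) ^ k)"
proof (intro exI conjI)
  define C where "C = 2 * diam_const d \<eta>"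
  show "C > 0" using diam_const_pos assms(1,5) by (simp add: C_def)
  have "whp (newman_watts d \<alpha> \<beta> \<sigma> \<zeta>)
      (\<lambda>n E. real (graph_diam (torus_verts d n) E) \<le> C * ln (real n) powr (\<kappa> + 1))"
    unfolding C_def using assms by (intro whp_diam_le_ln_powr)
  then show "whp (newman_watts d \<alpha> \<beta> \<sigma> \<zeta>)
      (\<lambda>n E. real (graph_diam (torus_verts d n) E) \<le> C * ln (real n) ^ k)"
  proof (rule whp_mono)
    have "\<forall>\<^sub>F n in sequentially. ln (real n) \<ge> 1" by real_asymp
    then show "\<forall>\<^sub>F n in sequentially. \<forall>E.
        real (graph_diam (torus_verts d n) E) \<le> C * ln (real n) powr (\<kappa> + 1) \<longrightarrow>
        real (graph_diam (torus_verts d n) E) \<le> C * ln (real n) ^ k"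
    proof eventually_elim
      case (elim n)
      then have "C * ln (real n) powr (\<kappa> + 1) \<le> C * ln (real n) powr real k"
        using assms(9) \<open>C > 0\<close> by (intro mult_left_mono powr_mono) auto
      then show ?case using elim by (auto simp: powr_realpow)
    qed
  qed
qed

theorem theorem1p1:
  fixes d :: nat and \<alpha> \<beta> :: real
  assumes "d \<ge> 1" and "0 < \<alpha>" and "\<alpha> < \<beta>" and "\<beta> < 1/2"
  shows
    "((2 * \<beta>) ^ d - (2 * \<alpha>) ^ d > 1/2 \<longrightarrow>
       (\<exists>\<sigma>\<^sub>0::real. \<forall>\<sigma> \<zeta>::real.
          \<sigma> > 0 \<and> (0 < \<zeta> \<and> \<zeta> < 1 \<or> \<zeta> = 0 \<and> \<sigma> \<ge> \<sigma>\<^sub>0) \<longrightarrow>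
          (\<exists>C\<^sub>1>0. (\<lambda>n::nat. measure_pmf.prob (newman_watts d \<alpha> \<beta> \<sigma> \<zeta> n)
              {E. real (graph_diam (torus_verts d n) E) \<le> C\<^sub>1 * (ln (real n)) ^ 3})
            \<longlonglongrightarrow> 1)) \<and>
       (\<exists>\<sigma>\<^sub>1::real. \<forall>\<sigma> \<zeta>::real.
          \<sigma> > 0 \<and> (\<zeta> > 1 \<or> \<zeta> = 1 \<and> \<sigma> \<ge> \<sigma>\<^sub>1) \<longrightarrow>
          (\<exists>C\<^sub>2>0. (\<lambda>n::nat. measure_pmf.prob (newman_watts d \<alpha> \<beta> \<sigma> \<zeta> n)
              {E. real (graph_diam (torus_verts d n) E) \<le> C\<^sub>2 * (ln (real n)) ^ 2})
            \<longlonglongrightarrow> 1))) \<and>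
     (\<forall>\<zeta>::real. \<zeta> < 1 \<longrightarrow>
       (\<forall>\<sigma>>0. \<forall>\<nu>::real. 0 < \<nu> \<and> \<nu> < (1 - \<zeta>) / real d \<longrightarrow>
          (\<lambda>n::nat. measure_pmf.prob (newman_watts d \<alpha> \<beta> \<sigma> \<zeta> n)
              {E. real (graph_diam (torus_verts d n) E) \<ge> ln (real n) powr \<nu>})
            \<longlonglongrightarrow> 1) \<and>
       (\<exists>\<sigma>\<^sub>2>0. \<forall>\<sigma>. 0 < \<sigma> \<and> \<sigma> \<le> \<sigma>\<^sub>2 \<longrightarrow>
          (\<lambda>n::nat. measure_pmf.prob (newman_watts d \<alpha> \<beta> \<sigma> \<zeta> n)
              {E. real (graph_diam (torus_verts d n) E) \<ge> ln (real n) powr ((1 - \<zeta>) / real d)})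
            \<longlonglongrightarrow> 1))"
  unfolding whp_def[symmetric]
proof (intro conjI allI impI)
  assume \<Gamma>: "(2 * \<beta>) ^ d - (2 * \<alpha>) ^ d > 1/2"
  define \<eta> where "\<eta> = ((2 * \<beta>) ^ d - (2 * \<alpha>) ^ d - 1/2) / 4"
  have expansion: "0 < \<eta>" "1/2 + 3 * \<eta> < (2 * \<beta>) ^ d - (2 * \<alpha>) ^ d"
    using \<Gamma> unfolding \<eta>_def by argo+
  note upper = whp_diam_le_ln_power[OF assms expansion]
  show "\<exists>\<sigma>\<^sub>0. \<forall>\<sigma> \<zeta>. \<sigma> > 0 \<and> (0 < \<zeta> \<and> \<zeta> < 1 \<or> \<zeta> = 0 \<and> \<sigma> \<ge> \<sigma>\<^sub>0) \<longrightarrow>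
      (\<exists>C\<^sub>1>0. whp (newman_watts d \<alpha> \<beta> \<sigma> \<zeta>)
        (\<lambda>n E. real (graph_diam (torus_verts d n) E) \<le> C\<^sub>1 * ln (real n) ^ 3))"
    using assms(1)
    by (intro exI[of _ "(4 * real d + 1) / \<eta>"] allI impI upper[where \<kappa> = "1 / real d"])
      (auto simp: field_simps)
  show "\<exists>\<sigma>\<^sub>1. \<forall>\<sigma> \<zeta>. \<sigma> > 0 \<and> (\<zeta> > 1 \<or> \<zeta> = 1 \<and> \<sigma> \<ge> \<sigma>\<^sub>1) \<longrightarrow>
      (\<exists>C\<^sub>2>0. whp (newman_watts d \<alpha> \<beta> \<sigma> \<zeta>)
        (\<lambda>n E. real (graph_diam (torus_verts d n) E) \<le> C\<^sub>2 * ln (real n) ^ 2))"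
    by (intro exI[of _ "(4 * real d + 1) / \<eta>"] allI impI upper[where \<kappa> = 0]) auto
next
  fix \<zeta> \<sigma> \<nu> :: real
  assume "\<zeta> < 1" "\<sigma> > 0" "0 < \<nu> \<and> \<nu> < (1 - \<zeta>) / real d"
  then show "whp (newman_watts d \<alpha> \<beta> \<sigma> \<zeta>)
      (\<lambda>n E. ln (real n) powr \<nu> \<le> real (graph_diam (torus_verts d n) E))"
    using assms by (intro whp_diam_ge) (auto simp: field_simps)
next
  fix \<zeta> :: real
  assume "\<zeta> < 1"
  then show "\<exists>\<sigma>\<^sub>2>0. \<forall>\<sigma>. 0 < \<sigma> \<and> \<sigma> \<le> \<sigma>\<^sub>2 \<longrightarrow> whp (newman_watts d \<alpha> \<beta> \<sigma> \<zeta>)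
      (\<lambda>n E. ln (real n) powr ((1 - \<zeta>) / real d) \<le> real (graph_diam (torus_verts d n) E))"
    using assms by (intro exI[of _ "1 / (8 * 3 ^ d)"] conjI allI impI whp_diam_ge) auto
qed

end
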